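(* The Pappus-Steiner system $\pi$ has no points of period $3$ over $\mathbb{Q}$. Moreover, for all sufficiently large primes $p$ (i.e. there is an integer $N$ such that for all primes $p>N$), $\pi$ has a point of period $3$ over $\mathbb{F}_p$ if and only if $$p\equiv 1,5,8,12 \pmod{13}\quad\text{or}\quad p\equiv 1,6\pmod 7.$$
   Context: For a field $k$, the Pappus-Steiner map is the partially defined map $\pi$ on $k^2$ given by $\pi([x,y])=\left[\frac{2y(y-x+2)}{(x-y)^2},\frac{y^2}{(x-y)^2}\right]$, defined for $x\neq y$. Let $W_1=\{[x,y]\in k^2: x=y\}$ and inductively $W_n=\{[x,y]\in k^2\setminus\bigcup_{i=1}^{n-1}W_i:\ \pi([x,y])\in W_{n-1}\}$ for $n\geq 2$. Put $\mathbb{A}=k^2\setminus\bigcup_{i\ge 1}W_i$; this is the set of points at which all iterates of $\pi$ are defined, and $\pi$ restricts to a map $\mathbb{A}\to\mathbb{A}$. The period of a point $z\in\mathbb{A}$ is the smallest integer $n>0$ with $\pi^n(z)=z$ (if one exists). "A point of period $n$ over $k$" means a point of $\mathbb{A}$ (formed with the field $k$) having period $n$. *)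

theory Defs
  imports
    "HOL-Algebra.Algebraic_Closure_Type"
    "HOL-Number_Theory.Residues"
begin

definition has_period :: "('a \<Rightarrow> 'a) \<Rightarrow> 'a \<Rightarrow> nat \<Rightarrow> bool" where
  "has_period f z n \<longleftrightarrow>
     n > 0 \<and> (f ^^ n) z = z \<and> (\<forall>m. 0 < m \<and> m < n \<longrightarrow> (f ^^ m) z \<noteq> z)"

context field
begin

text \<open>The map is partially defined. In HOL it also gets an arbitrary value where
  \<open>x = y\<close>; that value is never used, because such points form \<open>PS_W 1\<close> and are excluded
  both from \<open>PS_W n\<close> for \<open>n \<ge> 2\<close> and from \<open>PS_A\<close>.\<close>

fun pappus_steiner :: "'a \<times> 'a \<Rightarrow> 'a \<times> 'a" where
  "pappus_steiner (x, y) =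
     (((\<one> \<oplus> \<one>) \<otimes> y \<otimes> (y \<ominus> x \<oplus> (\<one> \<oplus> \<one>))) \<otimes> inv ((x \<ominus> y) [^] (2::nat)),
      (y [^] (2::nat)) \<otimes> inv ((x \<ominus> y) [^] (2::nat)))"

text \<open>The sets are indexed from \<open>1\<close>; the value at index \<open>0\<close> is a dummy.\<close>

fun PS_W :: "nat \<Rightarrow> ('a \<times> 'a) set" where
  "PS_W 0 = {}"
| "PS_W (Suc 0) = {(x, y) \<in> carrier R \<times> carrier R. x = y}"
| "PS_W (Suc (Suc n)) =
     {z \<in> carrier R \<times> carrier R - (\<Union>i\<in>{1..Suc n}. PS_W i).
        pappus_steiner z \<in> PS_W (Suc n)}"

definition PS_A :: "('a \<times> 'a) set" where
  "PS_A = carrier R \<times> carrier R - (\<Union>i\<in>{1..}. PS_W i)"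

definition PS_point_of_period :: "nat \<Rightarrow> 'a \<times> 'a \<Rightarrow> bool" where
  "PS_point_of_period n z \<longleftrightarrow> z \<in> PS_A \<and> has_period pappus_steiner z n"

end

end

theory Submission
  imports Defs
begin

text \<open>
  On a periodic orbit put \<open>A = 4 (x - y) / y\<close>. One step of the Pappus-Steiner map gives
  \<open>A\<^sub>i\<^sub>-\<^sub>1\<^sup>2 = 2 A\<^sub>i + A\<^sub>i\<^sub>+\<^sub>1 + 4\<close>, so that points of period 3 correspond to non-constant,
  nowhere vanishing solutions of a cyclic system of three quadratic equations. Multiplying the
  relations between consecutive differences \<open>A\<^sub>i - A\<^sub>i\<^sub>+\<^sub>1\<close> forces the sum of the three
  unknowns to be \<open>-1\<close> or \<open>-2\<close>, and then they are the roots of one of the two cyclic cubics of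
  conductor 13 and 7. Neither cubic has a rational root, since both are irreducible modulo 2.
  The roots are Gaussian periods up to an affine substitution, and Frobenius permutes the periods
  as multiplication by \<open>p\<close> permutes the cosets of the cubes in \<open>(\<int>/13)\<^sup>*\<close> and \<open>(\<int>/7)\<^sup>*\<close>.
\<close>

section \<open>Integer polynomials modulo a prime\<close>

text \<open>In the inductive step synthetic division splits off the factor \<open>X - n\<close>,
  with a remainder divisible by \<open>p\<close>. For \<open>j < n\<close> the difference
  \<open>j - n\<close> is nonzero modulo \<open>p\<close> because \<open>0 < n - j < p\<close>, so
  the quotient vanishes at all remaining points.\<close>

lemma int_poly_dvd_of_many_roots:
  fixes Q :: "int poly" and p :: nat
  assumes p: "prime p" and "n \<le> p" and "degree Q < n"
    and "\<And>j. j < n \<Longrightarrow> int p dvd poly Q (int j)"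
  shows "[:int p:] dvd Q"
  using assms(2-4)
proof (induction n arbitrary: Q)
  case 0
  then show ?case by simp
next
  case (Suc n)
  define q where "q = synthetic_div Q (int n)"
  have Q: "Q = [:- int n, 1:] * q + [:poly Q (int n):]"
    using synthetic_div_correct'[of "int n" Q] by (simp add: q_def)
  have c: "int p dvd poly Q (int n)"
    using Suc.prems(3) by blast
  have "[:int p:] dvd q"
  proof (cases "degree Q = 0")
    case True
    then have "q = 0" unfolding q_def by (subst synthetic_div_eq_0_iff)
    then show ?thesis by simp
  next
    case False
    show ?thesis
    proof (rule Suc.IH)
      show "n \<le> p" using Suc.prems by simp
      show "degree q < n" using Suc.prems False by (simp add: q_def degree_synthetic_div)
      fix j assume j: "j < n"
      have "poly Q (int j) = (int j - int n) * poly q (int j) + poly Q (int n)"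
        by (subst Q) (simp add: algebra_simps)
      with c Suc.prems(3)[of j] j have "int p dvd (int j - int n) * poly q (int j)"
        by (metis dvd_add_left_iff less_SucI)
      moreover have "\<not> int p dvd int j - int n"
        using j Suc.prems(1) by (auto dest!: zdvd_imp_le simp: dvd_diff_commute[of _ "int j"])
      ultimately show "int p dvd poly q (int j)"
        using p by (simp add: prime_dvd_mult_iff)
    qed
  qed
  with c show ?case
    by (subst Q) (intro dvd_add dvd_mult, auto simp: const_poly_dvd_iff coeff_pCons split: nat.splits)
qed

lemma fermat_dvd:
  assumes p: "prime (p::nat)"
  shows "int p dvd a ^ p - a"
proof -
  have p0: "p > 0" using p prime_gt_0_nat by blast
  define b where "b = nat (a mod int p)"
  have ab: "[a = int b] (mod int p)"
    using p0 by (simp add: b_def cong_def)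
  have "[b ^ p = b] (mod p)"
  proof (cases "p dvd b")
    case True
    moreover have "b dvd b ^ p"
      using p0 by (simp add: dvd_power)
    ultimately show ?thesis
      using dvd_trans by (auto simp: cong_def mod_eq_0_iff_dvd)
  next
    case False
    then have "[b * b ^ (p - 1) = b * 1] (mod p)"
      using fermat_theorem[OF p] cong_scalar_left by blast
    then show ?thesis
      using p0 by (simp add: power_eq_if)
  qed
  then have "[int b ^ p = int b] (mod int p)"
    by (metis cong_int_iff of_nat_power)
  then have "[a ^ p = a] (mod int p)"
    using cong_trans[OF cong_trans[OF cong_pow[OF ab]] cong_sym[OF ab]] by blast
  then show ?thesis
    by (simp add: cong_iff_dvd_diff)
qed

text \<open>Modulo \<open>p\<close> both polynomials are monic of degree \<open>p\<close> and vanish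
  at \<open>0, ..., p - 1\<close>, so their difference has lower degree but \<open>p\<close>
  roots.\<close>

lemma falling_product_dvd:
  assumes p: "prime (p::nat)"
  shows "[:int p:] dvd (\<Prod>j<p. [:- int j, 1:]) - (monom 1 p - monom 1 1)"
proof (rule int_poly_dvd_of_many_roots[OF p order_refl])
  have p1: "p > 1" using p prime_gt_1_nat by blast
  let ?F = "\<Prod>j<p. [:- int j, 1:]"
  have dF: "degree ?F = p"
    by (subst degree_prod_eq_sum_degree) auto
  have lF: "coeff ?F p = 1"
    using lead_coeff_prod[of "\<lambda>j. [:- int j, 1:]" "{..<p}"] dF by simp
  have "degree (?F - (monom 1 p - monom 1 1)) \<le> p"
    by (intro degree_diff_le) (use p1 in \<open>auto simp: dF degree_monom_eq\<close>)
  moreover have "coeff (?F - (monom 1 p - monom 1 1)) p = 0"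
    using p1 lF by simp
  ultimately show "degree (?F - (monom 1 p - monom 1 1)) < p"
    using p1 by (metis eq_zero_or_degree_less degree_0 less_trans zero_less_one)
  fix j assume j: "j < p"
  have "poly ?F (int j) = 0"
    using j by (auto simp: poly_prod)
  moreover have "int p dvd int j ^ p - int j"
    by (rule fermat_dvd[OF p])
  ultimately show "int p dvd poly (?F - (monom 1 p - monom 1 1)) (int j)"
    by (simp add: poly_monom dvd_diff_commute)
qed

section \<open>Gaussian periods modulo a prime\<close>

text \<open>
  Congruence in \<open>\<int>[\<zeta>\<^sub>n] / p\<close> is modelled by the ideal \<open>I\<close> generated by \<open>p\<close> and
  \<open>\<Phi> = 1 + z + \<dots> + z\<^sup>n\<^sup>-\<^sup>1\<close> in \<open>\<int>[z]\<close>.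
\<close>

locale cyclotomic_mod_prime =
  fixes n p :: nat
  assumes n: "n \<ge> 2" and p: "prime p"
begin

definition \<Phi> :: "int poly" where "\<Phi> = (\<Sum>i<n. monom 1 i)"

definition I :: "int poly set" where "I = {x. \<exists>u v. x = of_nat p * u + \<Phi> * v}"

abbreviation cg :: "int poly \<Rightarrow> int poly \<Rightarrow> bool" (infix "\<sim>" 50) where
  "x \<sim> y \<equiv> x - y \<in> I"

lemma I_add: "x \<in> I \<Longrightarrow> y \<in> I \<Longrightarrow> x + y \<in> I"
proof -
  assume "x \<in> I" "y \<in> I"
  then obtain u v u' v' where "x = of_nat p * u + \<Phi> * v" "y = of_nat p * u' + \<Phi> * v'"
    by (auto simp: I_def)
  then have "x + y = of_nat p * (u + u') + \<Phi> * (v + v')" by (simp add: algebra_simps)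
  then show "x + y \<in> I" unfolding I_def by blast
qed

lemma I_mult: "x \<in> I \<Longrightarrow> c * x \<in> I"
proof -
  assume "x \<in> I"
  then obtain u v where "x = of_nat p * u + \<Phi> * v" by (auto simp: I_def)
  then have "c * x = of_nat p * (c * u) + \<Phi> * (c * v)" by (simp add: algebra_simps)
  then show "c * x \<in> I" unfolding I_def by blast
qed

lemma I_mult2: "x \<in> I \<Longrightarrow> x * c \<in> I"
  using I_mult[of x c] by (simp add: mult.commute)

lemma I_p: "of_nat p * x \<in> I"
  unfolding I_def by (rule CollectI, rule exI[of _ x], rule exI[of _ 0]) simp

lemma I_Phi: "\<Phi> * x \<in> I"
  unfolding I_def by (rule CollectI, rule exI[of _ 0], rule exI[of _ x]) simp

lemma I_0 [simp]: "0 \<in> I" using I_p[of 0] by simp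

lemma I_minus: "x \<in> I \<Longrightarrow> - x \<in> I" using I_mult[of x "-1"] by simp

lemma I_diff: "x \<in> I \<Longrightarrow> y \<in> I \<Longrightarrow> x - y \<in> I" using I_add[of x "-y"] I_minus by simp

lemma cg_trans: "x \<sim> y \<Longrightarrow> y \<sim> z \<Longrightarrow> x \<sim> z"
  using I_add[of "x - y" "y - z"] by simp

lemma cg_sym: "x \<sim> y \<Longrightarrow> y \<sim> x"
  using I_minus[of "x - y"] by simp

lemma cg_mem: "x \<sim> y \<Longrightarrow> x \<in> I \<longleftrightarrow> y \<in> I"
  using I_add[of "x - y" y] I_diff[of x "x - y"] by auto

lemma I_power: "x \<in> I \<Longrightarrow> 0 < k \<Longrightarrow> x ^ k \<in> I"
  by (cases k) (auto intro: I_mult2)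

lemma cg_add: "x \<sim> y \<Longrightarrow> x' \<sim> y' \<Longrightarrow> x + x' \<sim> y + y'"
  using I_add[of "x - y" "x' - y'"] by (simp add: algebra_simps)

lemma cg_mult: "x \<sim> y \<Longrightarrow> x' \<sim> y' \<Longrightarrow> x * x' \<sim> y * y'"
  using I_add[OF I_mult[of "x' - y'" x] I_mult2[of "x - y" y']] by (simp add: algebra_simps)

lemma cg_power: "x \<sim> y \<Longrightarrow> x ^ k \<sim> y ^ k"
  by (induction k) (auto intro: cg_mult)

text \<open>This is what brings congruences modulo \<open>I\<close> back to the integers. As \<Phi>
  is monic of degree \<open>n - 1 > 0\<close>, the last coefficient of \<open>v\<close> not
  divisible by \<open>p\<close> would survive in a positive degree, where a constant has none. So
  \<open>p\<close> divides all of \<open>v\<close>, and then \<open>c\<close>.\<close>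

lemma int_in_I: assumes "of_int c \<in> I" shows "int p dvd c"
proof -
  obtain u v where uv: "of_int c = of_nat p * u + \<Phi> * v" using assms by (auto simp: I_def)
  have cphi: "coeff (\<Phi> * v) k = (\<Sum>i | i < n \<and> i \<le> k. coeff v (k - i))" for k
  proof -
    have "coeff (\<Phi> * v) k = (\<Sum>i<n. if i \<le> k then coeff v (k - i) else 0)"
      by (auto simp: \<Phi>_def sum_distrib_right coeff_sum coeff_monom_mult intro!: sum.cong)
    also have "\<dots> = (\<Sum>i | i < n \<and> i \<le> k. coeff v (k - i))"
      by (rule sum.mono_neutral_cong_right) auto
    finally show ?thesis .
  qed
  have cc: "coeff (of_int c :: int poly) k = int p * coeff u k + (\<Sum>i | i < n \<and> i \<le> k. coeff v (k - i))" for k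
    unfolding uv by (simp add: cphi of_nat_poly)
  have v: "int p dvd coeff v k" for k
  proof (rule ccontr)
    assume k: "\<not> int p dvd coeff v k"
    define S where "S = {k. \<not> int p dvd coeff v k}"
    have "S \<subseteq> {..degree v}"
      unfolding S_def using coeff_eq_0 by (metis (mono_tags, lifting) atMost_iff dvd_0_right leI mem_Collect_eq subsetI)
    then have fS: "finite S" using finite_subset by blast
    have "k \<in> S" using k by (simp add: S_def)
    define d where "d = Max S"
    have "d \<in> S" unfolding d_def using fS \<open>k \<in> S\<close> by (intro Max_in) auto
    have big: "int p dvd coeff v j" if "j > d" for j
      proof (rule ccontr)
      assume "\<not> int p dvd coeff v j"
      then have "j \<in> S" by (simp add: S_def)
      then have "j \<le> d" unfolding d_def by (rule Max_ge[OF fS])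
      with that show False by simp
    qed
    \<comment> \<open>In degree \<open>d + (n - 1)\<close> the term \<open>i = n - 1\<close>
      contributes \<open>coeff v d\<close>; all others involve coefficients of \<open>v\<close>
      beyond \<open>d\<close>.\<close>
    have "{i. i < n \<and> i \<le> d + (n - 1)} = insert (n - 1) {..<n - 1}" using n by auto
    then have "(\<Sum>i | i < n \<and> i \<le> d + (n - 1). coeff v (d + (n - 1) - i)) = coeff v d + (\<Sum>i<n-1. coeff v (d + (n - 1) - i))"
      by simp
    moreover have "coeff (of_int c :: int poly) (d + (n - 1)) = 0"
      using n by (simp add: of_int_poly coeff_pCons split: nat.splits)
    ultimately have "coeff v d = - (int p * coeff u (d + (n - 1)) + (\<Sum>i<n-1. coeff v (d + (n - 1) - i)))"
      using cc[of "d + (n - 1)"] by simp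
    moreover have "int p dvd (\<Sum>i<n-1. coeff v (d + (n - 1) - i))"
      by (intro dvd_sum big) auto
    ultimately have "int p dvd coeff v d" by simp
    with \<open>d \<in> S\<close> show False by (simp add: S_def)
  qed
  have "c = int p * coeff u 0 + (\<Sum>i | i < n \<and> i \<le> 0. coeff v (0 - i))"
    using cc[of 0] by (simp add: of_int_poly)
  with v show ?thesis by (simp add: dvd_sum)
qed

lemma cg_of_int: "int p dvd a - b \<Longrightarrow> of_int a \<sim> of_int b"
proof -
  assume "int p dvd a - b"
  then obtain k where "a - b = int p * k" by blast
  then have "of_int a - of_int b = (of_nat p * of_int k :: int poly)"
    by (metis of_int_diff of_int_mult of_int_of_nat_eq)
  then show "of_int a \<sim> of_int b" using I_p by simp
qed

section \<open>Frobenius modulo the ideal\<close>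

lemma frobenius_add: "(x + y) ^ p \<sim> x ^ p + y ^ p"
proof -
  have p0: "p > 0" using p prime_gt_0_nat by blast
  have "(x + y) ^ p = (\<Sum>k\<le>p. of_nat (p choose k) * x ^ k * y ^ (p - k))"
    by (rule binomial_ring)
  also have "{..p} = insert 0 (insert p {1..<p})" using p0 by auto
  also have "(\<Sum>k\<in>\<dots>. of_nat (p choose k) * x ^ k * y ^ (p - k)) = x ^ p + y ^ p + (\<Sum>k\<in>{1..<p}. of_nat (p choose k) * x ^ k * y ^ (p - k))"
    using p0 by simp
  also have "(\<Sum>k\<in>{1..<p}. of_nat (p choose k) * x ^ k * y ^ (p - k)) = of_nat p * (\<Sum>k\<in>{1..<p}. of_nat ((p choose k) div p) * x ^ k * y ^ (p - k))"
    unfolding sum_distrib_left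
  proof (rule sum.cong)
    fix k assume k: "k \<in> {1..<p}"
    then have "p dvd p choose k" using p by (intro dvd_choose_prime) auto
    then have "of_nat (p choose k) = (of_nat p * of_nat ((p choose k) div p) :: int poly)"
      by (metis dvd_mult_div_cancel of_nat_mult)
    then show "of_nat (p choose k) * x ^ k * y ^ (p - k) = of_nat p * (of_nat ((p choose k) div p) * x ^ k * y ^ (p - k))"
      by (simp add: mult.assoc)
  qed simp
  finally show ?thesis by (simp add: I_p)
qed

lemma frobenius_sum: "finite A \<Longrightarrow> (\<Sum>i\<in>A. f i) ^ p \<sim> (\<Sum>i\<in>A. f i ^ p)"
proof (induction A rule: finite_induct)
  case empty
  then show ?case using p prime_gt_0_nat[of p] by (simp add: power_0_left)
next
  case (insert a A)
  have "(f a + (\<Sum>i\<in>A. f i)) ^ p \<sim> f a ^ p + (\<Sum>i\<in>A. f i) ^ p"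
    by (rule frobenius_add)
  moreover have "f a ^ p + (\<Sum>i\<in>A. f i) ^ p \<sim> f a ^ p + (\<Sum>i\<in>A. f i ^ p)"
    using insert.IH by simp
  ultimately show ?case using insert.hyps by (auto intro: cg_trans)
qed

text \<open>Modulo \<Phi> the variable is an \<open>n\<close>-th root of unity, since
  \<open>(z - 1) * \<Phi> = z ^ n - 1\<close>.\<close>

lemma monom_mod_cg: "monom 1 k \<sim> monom 1 (k mod n)"
proof -
  have tel: "(monom 1 1 - 1) * \<Phi> = monom 1 n - 1"
    unfolding \<Phi>_def using power_diff_1_eq[of "monom (1::int) 1" n]
    by (simp add: monom_power)
  have "monom 1 n \<sim> (1 :: int poly)"
    using I_Phi[of "monom 1 1 - 1"] tel by (simp add: mult.commute)
  from cg_power[OF this, of "k div n"] have "monom 1 (n * (k div n)) \<sim> (1 :: int poly)"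
    by (simp add: monom_power)
  from cg_mult[OF this, of "monom 1 (k mod n)" "monom 1 (k mod n)"]
  show ?thesis by (simp add: mult_monom)
qed

text \<open>For a subgroup \<open>H\<close> of the units modulo \<open>n\<close> this is the
  Gaussian period of the coset \<open>m * H\<close>. With exponents reduced modulo \<open>n\<close>,
  representatives of one coset give equal polynomials and not merely congruent ones.\<close>

definition \<eta> :: "nat set \<Rightarrow> nat \<Rightarrow> int poly" where
  "\<eta> H m = (\<Sum>h\<in>H. monom 1 (h * m mod n))"

lemma frobenius_period: "finite H \<Longrightarrow> \<eta> H m ^ p \<sim> \<eta> H (m * (p mod n))"
proof -
  assume H: "finite H"
  have mon: "monom (1::int) (h * m mod n) ^ p \<sim> monom 1 (h * (m * (p mod n)) mod n)" for h
  proof -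
    have "monom (1::int) (h * m mod n) ^ p = monom 1 ((h * m mod n) * p)"
      by (simp add: monom_power)
    moreover have "(h * m mod n) * p mod n = h * (m * (p mod n)) mod n"
      by (metis mod_mult_left_eq mod_mult_right_eq mult.assoc)
    ultimately show ?thesis using monom_mod_cg by metis
  qed
  have sum: "(\<Sum>h\<in>H. f h) \<sim> (\<Sum>h\<in>H. g h)" if "\<And>h. f h \<sim> g h" for f g :: "nat \<Rightarrow> int poly"
    using H by (induction H rule: finite_induct) (use that in \<open>auto intro: cg_add\<close>)
  show ?thesis
    unfolding \<eta>_def by (rule cg_trans[OF frobenius_sum[OF H]], rule sum, rule mon)
qed

section \<open>Cubics with three roots modulo the ideal\<close>

context
  fixes x y z :: "int poly" and s t u :: int
  assumes e1: "x + y + z \<sim> of_int s"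
    and e2: "x * y + y * z + z * x \<sim> of_int t"
    and e3: "x * y * z \<sim> of_int u"
begin

lemma cubic_factors:
  "of_int (a ^ 3 - s * a ^ 2 + t * a - u) \<sim> (of_int a - x) * (of_int a - y) * (of_int a - z)"
proof -
  have "of_int (a ^ 3 - s * a ^ 2 + t * a - u) - (of_int a - x) * (of_int a - y) * (of_int a - z)
    = of_int a ^ 2 * (x + y + z - of_int s) - of_int a * (x * y + y * z + z * x - of_int t)
      + (x * y * z - of_int u)"
    by (simp add: algebra_simps power2_eq_square power3_eq_cube)
  then show ?thesis
    by (simp only:) (intro I_add I_diff I_mult e1 e2 e3)
qed

text \<open>
  If Frobenius fixes \<open>x\<close>, the product of all \<open>x - j\<close> with \<open>j < p\<close> vanishes. It divides the
  product of the values of the cubic at these \<open>j\<close>, which is therefore a multiple of \<open>p\<close>.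
\<close>

lemma cubic_root_if_fixed:
  assumes "x ^ p \<sim> x"
  shows "\<exists>a. int p dvd a ^ 3 - s * a ^ 2 + t * a - u"
proof -
  let ?f = "\<lambda>a. a ^ 3 - s * a ^ 2 + t * a - u"
  obtain K where K: "(\<Prod>j<p. [:- int j, 1:]) - (monom 1 p - monom 1 1) = [:int p:] * K"
    using falling_product_dvd[OF p] by blast
  have pcompose_monom: "pcompose (monom 1 k) x = x ^ k" for k
    by (induction k) (simp_all add: monom_0 monom_Suc pcompose_pCons pcompose_1)
  \<comment> \<open>Substituting \<open>x\<close> into the congruence between the product of all
    \<open>X - j\<close> and \<open>X ^ p - X\<close> keeps it valid modulo
    \<open>p\<close>.\<close>
  have "pcompose ((\<Prod>j<p. [:- int j, 1:]) - (monom 1 p - monom 1 1)) x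
    = (\<Prod>j<p. x - of_nat j) - (x ^ p - x)"
    by (simp add: pcompose_diff pcompose_prod pcompose_pCons pcompose_monom of_nat_poly)
      (simp only: diff_conv_add_uminus minus_pCons minus_zero add.commute)
  moreover have "pcompose ([:int p:] * K) x = of_nat p * pcompose K x"
    by (simp add: pcompose_smult of_nat_poly)
  ultimately have "(\<Prod>j<p. x - of_nat j) - (x ^ p - x) = of_nat p * pcompose K x"
    unfolding K by simp
  then have "(\<Prod>j<p. x - of_nat j) = of_nat p * pcompose K x + (x ^ p - x)"
    unfolding diff_eq_eq .
  then have 0: "(\<Prod>j<p. x - of_nat j) \<in> I"
    using assms I_p I_add by simp
  have "of_int (\<Prod>j<p. ?f (int j)) \<sim> (\<Prod>j<p. (of_int (int j) - x) * (of_int (int j) - y) * (of_int (int j) - z))"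
  proof -
    have "of_int (\<Prod>j\<in>A. ?f (int j)) \<sim> (\<Prod>j\<in>A. (of_int (int j) - x) * (of_int (int j) - y) * (of_int (int j) - z))"
      if "finite A" for A
      using that
    proof (induction A rule: finite_induct)
      case (insert j A)
      then show ?case using cg_mult[OF cubic_factors[of "int j"] insert.IH] by simp
    qed simp
    then show ?thesis by blast
  qed
  \<comment> \<open>The first factors form the product that vanishes modulo \<open>I\<close>; the
    signs from reversing them are moved to the remaining factors.\<close>
  moreover have "(\<Prod>j<p. (of_int (int j) - x) * (of_int (int j) - y) * (of_int (int j) - z))
    = (\<Prod>j<p. x - of_nat j) * (\<Prod>j<p. - ((of_int (int j) - y) * (of_int (int j) - z)))"
    unfolding prod.distrib[symmetric] by (rule prod.cong) (simp_all add: algebra_simps)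
  ultimately have "of_int (\<Prod>j<p. ?f (int j)) \<in> I"
    using cg_mem I_mult2[OF 0] by (simp only:)
  then have "int p dvd (\<Prod>j<p. ?f (int j))" by (rule int_in_I)
  then show ?thesis
    using p by (auto simp: prime_dvd_prod_iff)
qed

text \<open>
  For a root \<open>a\<close> the element \<open>x - a\<close> is nilpotent, its power with exponent \<open>1 + p + p\<^sup>2\<close> being the
  product of the three conjugates, and it is also fixed by the third power of Frobenius. Hence the
  cubic has a triple root, and \<open>s\<^sup>2 - 3 t\<close> vanishes.
\<close>

lemma no_cubic_root_if_moved:
  assumes "x ^ p \<sim> y" "y ^ p \<sim> z" "z ^ p \<sim> x" and disc: "\<not> int p dvd s ^ 2 - 3 * t"
  shows "\<not> int p dvd a ^ 3 - s * a ^ 2 + t * a - u"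
proof
  assume a: "int p dvd a ^ 3 - s * a ^ 2 + t * a - u"
  have prod: "(x - of_int a) * (y - of_int a) * (z - of_int a) \<in> I"
  proof -
    have "of_int (a ^ 3 - s * a ^ 2 + t * a - u) \<in> I"
      using cg_of_int[of "a ^ 3 - s * a ^ 2 + t * a - u" 0] a by simp
    then have "(of_int a - x) * (of_int a - y) * (of_int a - z) \<in> I"
      using cg_mem[OF cubic_factors[of a]] by blast
    moreover have "(x - of_int a) * (y - of_int a) * (z - of_int a) = - ((of_int a - x) * (of_int a - y) * (of_int a - z))"
      by (simp add: algebra_simps)
    ultimately show ?thesis using I_minus by simp
  qed
  \<comment> \<open>By Fermat's theorem Frobenius fixes the integer \<open>a\<close>, so it permutes
    the shifted roots in the same way as the roots.\<close>
  have frob: "(v - of_int a) ^ p \<sim> w - of_int a" if "v ^ p \<sim> w" for v w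
  proof -
    have fr: "(v + of_int (- a)) ^ p \<sim> v ^ p + of_int (- a) ^ p" by (rule frobenius_add)
    have "v ^ p + of_int (- a) ^ p \<sim> w + of_int (- a)"
      using cg_add[OF that cg_of_int[OF fermat_dvd[OF p, of "- a"]]] by simp
    from cg_trans[OF fr this] show ?thesis by simp
  qed
  have fx: "(x - of_int a) ^ p \<sim> y - of_int a" and fy: "(y - of_int a) ^ p \<sim> z - of_int a"
    and fz: "(z - of_int a) ^ p \<sim> x - of_int a"
    by (fact frob[OF assms(1)], fact frob[OF assms(2)], fact frob[OF assms(3)])
  have fxx: "(x - of_int a) ^ (p * p) \<sim> z - of_int a"
    using cg_trans[OF cg_power[OF fx, of p] fy] by (simp add: power_mult)
  have fxxx: "(x - of_int a) ^ (p * p * p) \<sim> x - of_int a"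
    using cg_trans[OF cg_power[OF fxx, of p] fz] by (simp add: power_mult)
  have "(x - of_int a) ^ 1 * (x - of_int a) ^ p * (x - of_int a) ^ (p * p) \<sim> (x - of_int a) * (y - of_int a) * (z - of_int a)"
    by (intro cg_mult fx fxx) simp
  from cg_mem[OF this] prod have "(x - of_int a) ^ 1 * (x - of_int a) ^ p * (x - of_int a) ^ (p * p) \<in> I"
    by blast
  then have "(x - of_int a) ^ (1 + p + p * p) \<in> I" by (simp only: power_add)
  \<comment> \<open>Raising the exponent to \<open>p * p * p\<close> keeps the power in
    \<open>I\<close>, and there the third power of Frobenius returns \<open>x - a\<close>
    itself.\<close>
  moreover have "1 + p + p * p \<le> p * p * p"
  proof -
    have "p \<ge> 2" using p prime_ge_2_nat by blast
    then obtain k where "p = k + 2" by (metis add.commute le_Suc_ex)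
    then show ?thesis by (simp add: algebra_simps)
  qed
  ultimately have "(x - of_int a) ^ (p * p * p) \<in> I"
    using I_mult2[of "(x - of_int a) ^ (1 + p + p * p)" "(x - of_int a) ^ (p * p * p - (1 + p + p * p))"]
    by (simp only: power_add[symmetric] le_add_diff_inverse)
  then have xa: "x - of_int a \<in> I"
    using cg_mem[OF fxxx] by blast
  have p0: "p > 0" using p prime_gt_0_nat by blast
  have step: "w - of_int a \<in> I" if "v - of_int a \<in> I" "(v - of_int a) ^ p \<sim> w - of_int a" for v w
  proof -
    have "(v - of_int a) ^ p \<in> I" using that(1) p0 by (rule I_power)
    then show ?thesis using cg_mem[OF that(2)] by blast
  qed
  have ya: "y - of_int a \<in> I" and za: "z - of_int a \<in> I"
    by (fact step[OF xa fx], fact step[OF step[OF xa fx] fy])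
  have "of_int a + of_int a + of_int a \<sim> x + y + z"
    using xa ya za by (intro cg_add) (auto intro: cg_sym)
  then have "of_int (3 * a - s) \<in> I"
    using cg_trans[OF _ e1] by (simp add: algebra_simps)
  then have 1: "int p dvd 3 * a - s" by (rule int_in_I)
  have "of_int a * of_int a + of_int a * of_int a + of_int a * of_int a \<sim> x * y + y * z + z * x"
    using xa ya za by (intro cg_add cg_mult) (auto intro: cg_sym)
  then have "of_int (3 * a * a - t) \<in> I"
    using cg_trans[OF _ e2] by (simp add: algebra_simps)
  then have 2: "int p dvd 3 * a * a - t" by (rule int_in_I)
  \<comment> \<open>Eliminates \<open>a\<close> from \<open>s = 3 a\<close> and
    \<open>t = 3 a^2\<close>, the relations of a triple root.\<close>
  have eq: "s ^ 2 - 3 * t = 3 * (3 * a * a - t) - (3 * a - s) * (3 * a + s)"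
    by (simp add: algebra_simps power2_eq_square)
  have "int p dvd s ^ 2 - 3 * t"
    unfolding eq
    using dvd_mult[OF 2, of 3] dvd_mult2[OF 1, of "3 * a + s"] by (rule dvd_diff)
  with disc show False by blast
qed

end

end

text \<open>The cubes modulo 7 form the subgroup \<open>{1, 6}\<close>, and the cubic has its three
  periods as roots. Frobenius fixes each period if \<open>p\<close> lies in this subgroup and
  otherwise permutes them cyclically.\<close>

lemma root_conductor_7_iff:
  assumes p: "prime (p::nat)" and "p \<noteq> 7"
  shows "(\<exists>a. int p dvd a ^ 3 + a\<^sup>2 - 2 * a - 1) \<longleftrightarrow> p mod 7 \<in> {1, 6}"
proof -
  have pr: "prime (7::nat)" by simp
  interpret cyclotomic_mod_prime 7 p by unfold_locales (use p in auto)
  define z where "z = monom (1::int) 1"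
  let ?\<eta> = "\<eta> {1, 6}"
  have monom: "monom 1 k = z ^ k" for k by (simp add: z_def monom_power)
  have \<eta>1: "?\<eta> 1 = z + z ^ 6" and \<eta>2: "?\<eta> 2 = z ^ 2 + z ^ 5" and \<eta>4: "?\<eta> 4 = z ^ 4 + z ^ 3"
    unfolding \<eta>_def monom by simp_all
  have \<Phi>: "\<Phi> = 1 + z + z ^ 2 + z ^ 3 + z ^ 4 + z ^ 5 + z ^ 6"
    unfolding \<Phi>_def monom by (simp add: lessThan_nat_numeral add_ac)
  have e1: "?\<eta> 1 + ?\<eta> 2 + ?\<eta> 4 - of_int (- 1) \<in> I"
  proof -
    have "?\<eta> 1 + ?\<eta> 2 + ?\<eta> 4 - of_int (- 1) = \<Phi> * 1"
      unfolding \<eta>1 \<eta>2 \<eta>4 \<Phi> by simp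
    then show ?thesis using I_Phi by metis
  qed
  have e2: "?\<eta> 1 * ?\<eta> 2 + ?\<eta> 2 * ?\<eta> 4 + ?\<eta> 4 * ?\<eta> 1 - of_int (- 2) \<in> I"
  proof -
    \<comment> \<open>The last factor is the quotient on division by \<Phi>; the same holds for the
      other symmetric functions.\<close>
    have "(z + z ^ 6) * (z ^ 2 + z ^ 5) + (z ^ 2 + z ^ 5) * (z ^ 4 + z ^ 3) + (z ^ 4 + z ^ 3) * (z + z ^ 6) + 2 = (1 + z + z ^ 2 + z ^ 3 + z ^ 4 + z ^ 5 + z ^ 6) * (2 - 2 * z + z ^ 3 + z ^ 5)" for z :: "int poly"
      by (simp add: algebra_simps eval_nat_numeral)
    from this[of z] have "?\<eta> 1 * ?\<eta> 2 + ?\<eta> 2 * ?\<eta> 4 + ?\<eta> 4 * ?\<eta> 1 - of_int (- 2) = \<Phi> * (2 - 2 * z + z ^ 3 + z ^ 5)"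
      unfolding \<eta>1 \<eta>2 \<eta>4 \<Phi> by simp
    then show ?thesis using I_Phi by metis
  qed
  have e3: "?\<eta> 1 * ?\<eta> 2 * ?\<eta> 4 - of_int (1) \<in> I"
  proof -
    have "(z + z ^ 6) * (z ^ 2 + z ^ 5) * (z ^ 4 + z ^ 3) - 1 = (1 + z + z ^ 2 + z ^ 3 + z ^ 4 + z ^ 5 + z ^ 6) * ( z + z ^ 6 - 1 - z ^ 7 + z ^ 9)" for z :: "int poly"
      by (simp add: algebra_simps eval_nat_numeral)
    from this[of z] have "?\<eta> 1 * ?\<eta> 2 * ?\<eta> 4 - of_int (1) = \<Phi> * ( z + z ^ 6 - 1 - z ^ 7 + z ^ 9)"
      unfolding \<eta>1 \<eta>2 \<eta>4 \<Phi> by simp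
    then show ?thesis using I_Phi by metis
  qed
  \<comment> \<open>The relations with the second and third period exchanged serve the coset
    \<open>{3, 4}\<close>, for which Frobenius runs through the cycle in the opposite
    direction.\<close>
  have e2': "?\<eta> 1 * ?\<eta> 4 + ?\<eta> 4 * ?\<eta> 2 + ?\<eta> 2 * ?\<eta> 1 - of_int (- 2) \<in> I"
    using e2 by (simp add: algebra_simps)
  have e1': "?\<eta> 1 + ?\<eta> 4 + ?\<eta> 2 - of_int (- 1) \<in> I"
    using e1 by (simp add: algebra_simps)
  have e3': "?\<eta> 1 * ?\<eta> 4 * ?\<eta> 2 - of_int (1) \<in> I"
    using e3 by (simp add: algebra_simps)
  \<comment> \<open>Here \<open>s^2 - 3 t\<close> equals 7, so only \<open>p = 7\<close> has to be
    excluded.\<close>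
  have disc: "\<not> int p dvd (- 1)\<^sup>2 - 3 * (- 2)"
  proof -
    have "\<not> p dvd 7"
      using primes_dvd_imp_eq[OF p pr] \<open>p \<noteq> 7\<close> by blast
    then have "\<not> int p dvd int 7" by (simp only: int_dvd_int_iff simp_thms)
    then show ?thesis by simp
  qed
  have frob: "?\<eta> m ^ p - ?\<eta> (m * (p mod 7)) \<in> I" for m
    by (rule frobenius_period) simp
  have "p mod 7 < 7" by simp
  moreover have "p mod 7 \<noteq> 0"
    using p \<open>p \<noteq> 7\<close> primes_dvd_imp_eq[OF pr p] by (auto simp: mod_eq_0_iff_dvd)
  moreover have "k < 7 \<Longrightarrow> k \<noteq> 0 \<Longrightarrow> k \<in> {1, 6} \<or> k \<in> {2, 5} \<or> k \<in> {3, 4}" for k :: nat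
    unfolding insert_iff empty_iff by presburger
  ultimately consider "p mod 7 \<in> {1, 6}" | "p mod 7 \<in> {2, 5}" | "p mod 7 \<in> {3, 4}"
    by blast
  then show ?thesis
  proof cases
    case 1
    then have "?\<eta> (1 * (p mod 7)) = ?\<eta> 1"
      by (auto simp: \<eta>_def)
    then show ?thesis
      using cubic_root_if_fixed[OF e1 e2 e3] frob[of 1] 1 by simp
  next
    case 2
    then have "?\<eta> (1 * (p mod 7)) = ?\<eta> 2" "?\<eta> (2 * (p mod 7)) = ?\<eta> 4" "?\<eta> (4 * (p mod 7)) = ?\<eta> 1"
      by (auto simp: \<eta>_def)
    then show ?thesis
      using no_cubic_root_if_moved[OF e1 e2 e3 _ _ _ disc] frob[of 1] frob[of 2] frob[of 4] 2 by auto
  next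
    case 3
    then have "?\<eta> (1 * (p mod 7)) = ?\<eta> 4" "?\<eta> (4 * (p mod 7)) = ?\<eta> 2" "?\<eta> (2 * (p mod 7)) = ?\<eta> 1"
      by (auto simp: \<eta>_def)
    then show ?thesis
      using no_cubic_root_if_moved[OF e1' e2' e3' _ _ _ disc] frob[of 1] frob[of 2] frob[of 4] 3 by auto
  qed
qed

text \<open>The argument for 7 carries over, with the subgroup \<open>{1, 5, 8, 12}\<close> of cubes
  modulo 13 and \<open>s^2 - 3 t = 13\<close>.\<close>

lemma root_conductor_13_iff:
  assumes p: "prime (p::nat)" and "p \<noteq> 13"
  shows "(\<exists>a. int p dvd a ^ 3 + a\<^sup>2 - 4 * a + 1) \<longleftrightarrow> p mod 13 \<in> {1, 5, 8, 12}"
proof -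
  have pr: "prime (13::nat)" by simp
  interpret cyclotomic_mod_prime 13 p by unfold_locales (use p in auto)
  define z where "z = monom (1::int) 1"
  let ?\<eta> = "\<eta> {1, 5, 8, 12}"
  have monom: "monom 1 k = z ^ k" for k by (simp add: z_def monom_power)
  have \<eta>1: "?\<eta> 1 = z + z ^ 5 + z ^ 8 + z ^ 12" and \<eta>2: "?\<eta> 2 = z ^ 2 + z ^ 10 + z ^ 3 + z ^ 11" and \<eta>4: "?\<eta> 4 = z ^ 4 + z ^ 7 + z ^ 6 + z ^ 9"
    unfolding \<eta>_def monom by simp_all
  have \<Phi>: "\<Phi> = 1 + z + z ^ 2 + z ^ 3 + z ^ 4 + z ^ 5 + z ^ 6 + z ^ 7 + z ^ 8 + z ^ 9 + z ^ 10 + z ^ 11 + z ^ 12"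
    unfolding \<Phi>_def monom by (simp add: lessThan_nat_numeral add_ac)
  have e1: "?\<eta> 1 + ?\<eta> 2 + ?\<eta> 4 - of_int (- 1) \<in> I"
  proof -
    have "?\<eta> 1 + ?\<eta> 2 + ?\<eta> 4 - of_int (- 1) = \<Phi> * 1"
      unfolding \<eta>1 \<eta>2 \<eta>4 \<Phi> by simp
    then show ?thesis using I_Phi by metis
  qed
  have e2: "?\<eta> 1 * ?\<eta> 2 + ?\<eta> 2 * ?\<eta> 4 + ?\<eta> 4 * ?\<eta> 1 - of_int (- 4) \<in> I"
  proof -
    have "(z + z ^ 5 + z ^ 8 + z ^ 12) * (z ^ 2 + z ^ 10 + z ^ 3 + z ^ 11) + (z ^ 2 + z ^ 10 + z ^ 3 + z ^ 11) * (z ^ 4 + z ^ 7 + z ^ 6 + z ^ 9) + (z ^ 4 + z ^ 7 + z ^ 6 + z ^ 9) * (z + z ^ 5 + z ^ 8 + z ^ 12) + 4 = (1 + z + z ^ 2 + z ^ 3 + z ^ 4 + z ^ 5 + z ^ 6 + z ^ 7 + z ^ 8 + z ^ 9 + z ^ 10 + z ^ 11 + z ^ 12) * (4 - 4 * z + z ^ 3 + 2 * z ^ 7 + z ^ 11)" for z :: "int poly"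
      by (simp add: algebra_simps eval_nat_numeral)
    from this[of z] have "?\<eta> 1 * ?\<eta> 2 + ?\<eta> 2 * ?\<eta> 4 + ?\<eta> 4 * ?\<eta> 1 - of_int (- 4) = \<Phi> * (4 - 4 * z + z ^ 3 + 2 * z ^ 7 + z ^ 11)"
      unfolding \<eta>1 \<eta>2 \<eta>4 \<Phi> by simp
    then show ?thesis using I_Phi by metis
  qed
  have e3: "?\<eta> 1 * ?\<eta> 2 * ?\<eta> 4 - of_int (- 1) \<in> I"
  proof -
    have "(z + z ^ 5 + z ^ 8 + z ^ 12) * (z ^ 2 + z ^ 10 + z ^ 3 + z ^ 11) * (z ^ 4 + z ^ 7 + z ^ 6 + z ^ 9) + 1 = (1 + z + z ^ 2 + z ^ 3 + z ^ 4 + z ^ 5 + z ^ 6 + z ^ 7 + z ^ 8 + z ^ 9 + z ^ 10 + z ^ 11 + z ^ 12) * (1 - z + z ^ 7 + z ^ 10 + z ^ 13 + z ^ 17 + z ^ 20)" for z :: "int poly"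
      by (simp add: algebra_simps eval_nat_numeral)
    from this[of z] have "?\<eta> 1 * ?\<eta> 2 * ?\<eta> 4 - of_int (- 1) = \<Phi> * (1 - z + z ^ 7 + z ^ 10 + z ^ 13 + z ^ 17 + z ^ 20)"
      unfolding \<eta>1 \<eta>2 \<eta>4 \<Phi> by simp
    then show ?thesis using I_Phi by metis
  qed
  have e2': "?\<eta> 1 * ?\<eta> 4 + ?\<eta> 4 * ?\<eta> 2 + ?\<eta> 2 * ?\<eta> 1 - of_int (- 4) \<in> I"
    using e2 by (simp add: algebra_simps)
  have e1': "?\<eta> 1 + ?\<eta> 4 + ?\<eta> 2 - of_int (- 1) \<in> I"
    using e1 by (simp add: algebra_simps)
  have e3': "?\<eta> 1 * ?\<eta> 4 * ?\<eta> 2 - of_int (- 1) \<in> I"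
    using e3 by (simp add: algebra_simps)
  have disc: "\<not> int p dvd (- 1)\<^sup>2 - 3 * (- 4)"
  proof -
    have "\<not> p dvd 13"
      using primes_dvd_imp_eq[OF p pr] \<open>p \<noteq> 13\<close> by blast
    then have "\<not> int p dvd int 13" by (simp only: int_dvd_int_iff simp_thms)
    then show ?thesis by simp
  qed
  have frob: "?\<eta> m ^ p - ?\<eta> (m * (p mod 13)) \<in> I" for m
    by (rule frobenius_period) simp
  have "p mod 13 < 13" by simp
  moreover have "p mod 13 \<noteq> 0"
    using p \<open>p \<noteq> 13\<close> primes_dvd_imp_eq[OF pr p] by (auto simp: mod_eq_0_iff_dvd)
  moreover have "k < 13 \<Longrightarrow> k \<noteq> 0 \<Longrightarrow> k \<in> {1, 5, 8, 12} \<or> k \<in> {2, 3, 10, 11} \<or> k \<in> {4, 6, 7, 9}" for k :: nat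
    unfolding insert_iff empty_iff by presburger
  ultimately consider "p mod 13 \<in> {1, 5, 8, 12}" | "p mod 13 \<in> {2, 3, 10, 11}" | "p mod 13 \<in> {4, 6, 7, 9}"
    by blast
  then show ?thesis
  proof cases
    case 1
    then have "?\<eta> (1 * (p mod 13)) = ?\<eta> 1"
      by (auto simp: \<eta>_def)
    then show ?thesis
      using cubic_root_if_fixed[OF e1 e2 e3] frob[of 1] 1 by simp
  next
    case 2
    then have "?\<eta> (1 * (p mod 13)) = ?\<eta> 2" "?\<eta> (2 * (p mod 13)) = ?\<eta> 4" "?\<eta> (4 * (p mod 13)) = ?\<eta> 1"
      by (auto simp: \<eta>_def)
    then show ?thesis
      using no_cubic_root_if_moved[OF e1 e2 e3 _ _ _ disc] frob[of 1] frob[of 2] frob[of 4] 2 by auto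
  next
    case 3
    then have "?\<eta> (1 * (p mod 13)) = ?\<eta> 4" "?\<eta> (4 * (p mod 13)) = ?\<eta> 2" "?\<eta> (2 * (p mod 13)) = ?\<eta> 1"
      by (auto simp: \<eta>_def)
    then show ?thesis
      using no_cubic_root_if_moved[OF e1' e2' e3' _ _ _ disc] frob[of 1] frob[of 2] frob[of 4] 3 by auto
  qed
qed

section \<open>The cyclic system of quadratic equations\<close>

lemma dvd_eqI: "x = y \<Longrightarrow> q dvd y \<Longrightarrow> q dvd x"
  by simp

text \<open>
  Everything is stated up to multiples of \<open>q\<close>, which covers the rationals (\<open>q = 0\<close>, where
  divisibility by \<open>q\<close> means being zero) and residue fields at once.
\<close>

lemma three_cycle_iff_cubic_root:
  fixes q :: "'a::comm_ring_1"
  assumes prime: "\<And>u v. q dvd u * v \<Longrightarrow> q dvd u \<or> q dvd v"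
    and 2: "\<not> q dvd 2" and 3: "\<not> q dvd 3" and 7: "\<not> q dvd 7" and 13: "\<not> q dvd 13"
  shows "(\<exists>A B C. q dvd A\<^sup>2 - (2 * B + C + 4) \<and> q dvd B\<^sup>2 - (2 * C + A + 4) \<and> q dvd C\<^sup>2 - (2 * A + B + 4) \<and>
      \<not> (q dvd A - B \<and> q dvd B - C) \<and> \<not> q dvd A \<and> \<not> q dvd B \<and> \<not> q dvd C)
    \<longleftrightarrow> (\<exists>a. q dvd a ^ 3 + a\<^sup>2 - 2 * a - 1) \<or> (\<exists>a. q dvd a ^ 3 + a\<^sup>2 - 4 * a + 1)" (is "?L \<longleftrightarrow> ?R")
proof
  assume ?L
  then obtain A B C where E1: "q dvd A\<^sup>2 - (2 * B + C + 4)" and E2: "q dvd B\<^sup>2 - (2 * C + A + 4)"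
    and E3: "q dvd C\<^sup>2 - (2 * A + B + 4)" and ne: "\<not> (q dvd A - B \<and> q dvd B - C)"
    by blast
  \<comment> \<open>Subtracting consecutive equations expresses each difference of unknowns as a
    multiple of the preceding one.\<close>
  have uv: "q dvd (A - B) * (A + B + 1) - (B - C)"
  proof (rule dvd_eqI)
    show "(A - B) * (A + B + 1) - (B - C) = (A\<^sup>2 - (2 * B + C + 4)) - (B\<^sup>2 - (2 * C + A + 4))"
      by (simp add: algebra_simps power2_eq_square)
    show "q dvd (A\<^sup>2 - (2 * B + C + 4)) - (B\<^sup>2 - (2 * C + A + 4))" by (rule dvd_diff[OF E1 E2])
  qed
  have vw: "q dvd (B - C) * (B + C + 1) - (C - A)"
  proof (rule dvd_eqI)
    show "(B - C) * (B + C + 1) - (C - A) = (B\<^sup>2 - (2 * C + A + 4)) - (C\<^sup>2 - (2 * A + B + 4))"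
      by (simp add: algebra_simps power2_eq_square)
    show "q dvd (B\<^sup>2 - (2 * C + A + 4)) - (C\<^sup>2 - (2 * A + B + 4))" by (rule dvd_diff[OF E2 E3])
  qed
  have wu: "q dvd (C - A) * (C + A + 1) - (A - B)"
  proof (rule dvd_eqI)
    show "(C - A) * (C + A + 1) - (A - B) = (C\<^sup>2 - (2 * A + B + 4)) - (A\<^sup>2 - (2 * B + C + 4))"
      by (simp add: algebra_simps power2_eq_square)
    show "q dvd (C\<^sup>2 - (2 * A + B + 4)) - (A\<^sup>2 - (2 * B + C + 4))" by (rule dvd_diff[OF E3 E1])
  qed
  \<comment> \<open>If one difference vanished, all would; a non-constant solution therefore has
    three nonzero differences.\<close>
  have step: "q dvd v" if "q dvd u * k - v" "q dvd u" for u v k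
    using dvd_diff[OF dvd_mult2[OF that(2), of k] that(1)] by simp
  have u: "\<not> q dvd A - B" and v: "\<not> q dvd B - C" and w: "\<not> q dvd C - A"
    using ne step[OF uv] step[OF vw] step[OF wu] by blast+
  \<comment> \<open>The differences sum to zero and have the form \<open>x\<close>,
    \<open>k x\<close>, \<open>k l x\<close>, so the nonzero factor \<open>x\<close>
    cancels.\<close>
  have key: "q dvd 1 + k + k * l"
    if "q dvd x * k - y" "q dvd y * l - z" "x + y + z = 0" "\<not> q dvd x" for x y z k l
  proof -
    have "x * (1 + k + k * l) = (x + y + z) + (x * k - y) * (1 + l) + (y * l - z)"
      by (simp add: algebra_simps)
    then have "q dvd x * (1 + k + k * l)"
      using that(1-3) by simp
    with prime that(4) show ?thesis by blast
  qed
  have k1: "q dvd 1 + (A + B + 1) + (A + B + 1) * (B + C + 1)"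
    by (rule key[OF uv vw _ u]) simp
  have k2: "q dvd 1 + (B + C + 1) + (B + C + 1) * (C + A + 1)"
    by (rule key[OF vw wu _ v]) simp
  have k3: "q dvd 1 + (C + A + 1) + (C + A + 1) * (A + B + 1)"
    by (rule key[OF wu uv _ w]) simp
  \<comment> \<open>Symmetrizing the three relations and using the equations themselves leaves a
    quadratic in the sum \<open>A + B + C\<close>, which factors.\<close>
  have "3 * ((A + B + C + 1) * (A + B + C + 2)) =
      2 * ((1 + (A + B + 1) + (A + B + 1) * (B + C + 1)) + (1 + (B + C + 1) + (B + C + 1) * (C + A + 1))
        + (1 + (C + A + 1) + (C + A + 1) * (A + B + 1)))
      + ((A\<^sup>2 - (2 * B + C + 4)) + (B\<^sup>2 - (2 * C + A + 4)) + (C\<^sup>2 - (2 * A + B + 4)))"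
    by (simp add: algebra_simps power2_eq_square)
  also have "q dvd \<dots>"
    by (intro dvd_add dvd_mult E1 E2 E3 k1 k2 k3)
  finally have "q dvd A + B + C + 1 \<or> q dvd A + B + C + 2"
    using prime 3 by blast
  then show ?R
  proof
    assume s: "q dvd A + B + C + 1"
    \<comment> \<open>\<open>b\<close> and \<open>c\<close> are the values of \<open>B\<close> and
      \<open>C\<close> obtained from the first equation and the known sum.\<close>
    define b where "b = A\<^sup>2 + A - 3"
    define c where "c = 2 - 2 * A - A\<^sup>2"
    have bB: "q dvd B - b"
    proof (rule dvd_eqI)
      show "B - b = - ((A\<^sup>2 - (2 * B + C + 4)) + (A + B + C + 1))"
        by (simp add: b_def algebra_simps)
    qed (simp only: dvd_minus_iff dvd_add[OF E1 s])
    have cC: "q dvd C - c"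
    proof (rule dvd_eqI)
      show "C - c = (A + B + C + 1) - (B - b)"
        by (simp add: b_def c_def algebra_simps)
    qed (rule dvd_diff[OF s bB])
    \<comment> \<open>After elimination the second and third equations become \<open>(A + 1)\<close>
      and \<open>(A + 3)\<close> times the cubic, so their difference is twice the cubic.\<close>
    have "q dvd 2 * (A ^ 3 + A\<^sup>2 - 4 * A + 1)"
    proof (rule dvd_eqI)
      have "2 * (A ^ 3 + A\<^sup>2 - 4 * A + 1) = (c\<^sup>2 - (2 * A + b + 4)) - (b\<^sup>2 - (2 * c + A + 4))"
        by (simp add: b_def c_def algebra_simps eval_nat_numeral)
      also have "\<dots> = ((C\<^sup>2 - (2 * A + B + 4)) - (C - c) * (C + c) + (B - b))
          - ((B\<^sup>2 - (2 * C + A + 4)) - (B - b) * (B + b) + 2 * (C - c))"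
        by (simp add: algebra_simps power2_eq_square)
      finally show "2 * (A ^ 3 + A\<^sup>2 - 4 * A + 1) = \<dots>" .
    qed (intro dvd_add dvd_diff dvd_mult2[OF bB] dvd_mult2[OF cC] dvd_mult[OF cC] E2 E3 bB)
    with prime 2 have f: "q dvd A ^ 3 + A\<^sup>2 - 4 * A + 1" by blast
    then show ?R by blast
  next
    assume s: "q dvd A + B + C + 2"
    define b where "b = A\<^sup>2 + A - 2"
    define c where "c = - 2 * A - A\<^sup>2"
    have bB: "q dvd B - b"
    proof (rule dvd_eqI)
      show "B - b = - ((A\<^sup>2 - (2 * B + C + 4)) + (A + B + C + 2))"
        by (simp add: b_def algebra_simps)
    qed (simp only: dvd_minus_iff dvd_add[OF E1 s])
    have cC: "q dvd C - c"
    proof (rule dvd_eqI)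
      show "C - c = (A + B + C + 2) - (B - b)"
        by (simp add: b_def c_def algebra_simps)
    qed (rule dvd_diff[OF s bB])
    have "q dvd 2 * (A ^ 3 + 2 * A\<^sup>2 - A - 1)"
    proof (rule dvd_eqI)
      have "2 * (A ^ 3 + 2 * A\<^sup>2 - A - 1) = (c\<^sup>2 - (2 * A + b + 4)) - (b\<^sup>2 - (2 * c + A + 4))"
        by (simp add: b_def c_def algebra_simps eval_nat_numeral)
      also have "\<dots> = ((C\<^sup>2 - (2 * A + B + 4)) - (C - c) * (C + c) + (B - b))
          - ((B\<^sup>2 - (2 * C + A + 4)) - (B - b) * (B + b) + 2 * (C - c))"
        by (simp add: algebra_simps power2_eq_square)
      finally show "2 * (A ^ 3 + 2 * A\<^sup>2 - A - 1) = \<dots>" .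
    qed (intro dvd_add dvd_diff dvd_mult2[OF bB] dvd_mult2[OF cC] dvd_mult[OF cC] E2 E3 bB)
    with prime 2 have f: "q dvd A ^ 3 + 2 * A\<^sup>2 - A - 1" by blast
    \<comment> \<open>The substitution \<open>a = - 1 - A\<close> leads to the cubic of the Gaussian
      periods of conductor 7.\<close>
    have "(- 1 - A) ^ 3 + (- 1 - A)\<^sup>2 - 2 * (- 1 - A) - 1 = - (A ^ 3 + 2 * A\<^sup>2 - A - 1)"
      by (simp add: algebra_simps eval_nat_numeral)
    then have "q dvd (- 1 - A) ^ 3 + (- 1 - A)\<^sup>2 - 2 * (- 1 - A) - 1"
      by (rule dvd_eqI) (simp only: dvd_minus_iff f)
    then show ?R by blast
  qed
next
  have 1: "\<not> q dvd 1" using 2 dvd_trans[of q 1 2] by auto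
  assume ?R
  then show ?L
  proof
    assume "\<exists>a. q dvd a ^ 3 + a\<^sup>2 - 2 * a - 1"
    then obtain a where a: "q dvd a ^ 3 + a\<^sup>2 - 2 * a - 1" by blast
    define A where "A = - 1 - a"
    have f: "q dvd A ^ 3 + 2 * A\<^sup>2 - A - 1"
    proof (rule dvd_eqI)
      show "A ^ 3 + 2 * A\<^sup>2 - A - 1 = - (a ^ 3 + a\<^sup>2 - 2 * a - 1)"
        by (simp add: A_def algebra_simps eval_nat_numeral)
    qed (simp only: dvd_minus_iff a)
    define b where "b = A\<^sup>2 + A - 2"
    define c where "c = - 2 * A - A\<^sup>2"
    have i1: "A\<^sup>2 - (2 * b + c + 4) = 0"
      by (simp add: b_def c_def algebra_simps)
    have i2: "b\<^sup>2 - (2 * c + A + 4) = A * (A ^ 3 + 2 * A\<^sup>2 - A - 1)"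
      by (simp add: b_def c_def algebra_simps eval_nat_numeral)
    have i3: "c\<^sup>2 - (2 * A + b + 4) = (A + 2) * (A ^ 3 + 2 * A\<^sup>2 - A - 1)"
      by (simp add: b_def c_def algebra_simps eval_nat_numeral)
    \<comment> \<open>Modulo the cubic the product \<open>A * b * c\<close> is 1, so no unknown
      vanishes.\<close>
    have i4: "1 = A * b * c + (A\<^sup>2 + A - 1) * (A ^ 3 + 2 * A\<^sup>2 - A - 1)"
      by (simp add: b_def c_def algebra_simps eval_nat_numeral)
    \<comment> \<open>The number 7 is a combination of \<open>A - b\<close> and the cubic, so
      \<open>A\<close> and \<open>b\<close> differ.\<close>
    have i5: "7 = (A - b) * (- 1 - (A - 3) * (A + 2)) + (3 - A) * (A ^ 3 + 2 * A\<^sup>2 - A - 1)"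
      by (simp add: b_def algebra_simps eval_nat_numeral)
    have E: "q dvd A\<^sup>2 - (2 * b + c + 4)" "q dvd b\<^sup>2 - (2 * c + A + 4)" "q dvd c\<^sup>2 - (2 * A + b + 4)"
      unfolding i1 i2 i3 using f by simp_all
    have "\<not> q dvd A * b * c"
    proof
      assume "q dvd A * b * c"
      then have "q dvd 1"
        by (intro dvd_eqI[OF i4] dvd_add dvd_diff dvd_mult[OF f]) auto
      with 1 show False by blast
    qed
    then have nz: "\<not> q dvd A" "\<not> q dvd b" "\<not> q dvd c"
      by auto
    have "\<not> q dvd A - b"
    proof
      assume "q dvd A - b"
      then have "q dvd 7"
        by (intro dvd_eqI[OF i5] dvd_add dvd_mult[OF f] dvd_mult2)
      with 7 show False by blast
    qed
    with E nz show ?L by blast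
  next
    assume "\<exists>a. q dvd a ^ 3 + a\<^sup>2 - 4 * a + 1"
    then obtain A where f: "q dvd A ^ 3 + A\<^sup>2 - 4 * A + 1" by blast
    define b where "b = A\<^sup>2 + A - 3"
    define c where "c = 2 - 2 * A - A\<^sup>2"
    have i1: "A\<^sup>2 - (2 * b + c + 4) = 0"
      by (simp add: b_def c_def algebra_simps)
    have i2: "b\<^sup>2 - (2 * c + A + 4) = (A + 1) * (A ^ 3 + A\<^sup>2 - 4 * A + 1)"
      by (simp add: b_def c_def algebra_simps eval_nat_numeral)
    have i3: "c\<^sup>2 - (2 * A + b + 4) = (A + 3) * (A ^ 3 + A\<^sup>2 - 4 * A + 1)"
      by (simp add: b_def c_def algebra_simps eval_nat_numeral)
    \<comment> \<open>As before: the product is now \<open>- 1\<close> modulo the cubic, and 13 is a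
      combination of \<open>A - b\<close> and the cubic.\<close>
    have i4: "1 = - (A * b * c) - (A\<^sup>2 + 2 * A - 1) * (A ^ 3 + A\<^sup>2 - 4 * A + 1)"
      by (simp add: b_def c_def algebra_simps eval_nat_numeral)
    have i5: "13 = (A - b) * ((A + 4) * (A + 1) - 1) + (A + 4) * (A ^ 3 + A\<^sup>2 - 4 * A + 1)"
      by (simp add: b_def algebra_simps eval_nat_numeral)
    have E: "q dvd A\<^sup>2 - (2 * b + c + 4)" "q dvd b\<^sup>2 - (2 * c + A + 4)" "q dvd c\<^sup>2 - (2 * A + b + 4)"
      unfolding i1 i2 i3 using f by simp_all
    have "\<not> q dvd A * b * c"
    proof
      assume "q dvd A * b * c"
      then have "q dvd 1"
        by (intro dvd_eqI[OF i4] dvd_add dvd_diff dvd_mult[OF f]) auto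
      with 1 show False by blast
    qed
    then have nz: "\<not> q dvd A" "\<not> q dvd b" "\<not> q dvd c"
      by auto
    have "\<not> q dvd A - b"
    proof
      assume "q dvd A - b"
      then have "q dvd 13"
        by (intro dvd_eqI[OF i5] dvd_add dvd_mult[OF f] dvd_mult2)
      with 13 show False by blast
    qed
    with E nz show ?L by blast
  qed
qed

section \<open>Points of period 3 over a field\<close>

context field
begin

section \<open>The domain of all iterates\<close>

lemma pappus_steiner_closed:
  assumes "z \<in> carrier R \<times> carrier R" "fst z \<noteq> snd z"
  shows "pappus_steiner z \<in> carrier R \<times> carrier R"
proof -
  obtain x y where z: "z = (x, y)" by (cases z)
  have xy: "x \<in> carrier R" "y \<in> carrier R" "x \<noteq> y" using assms z by auto
  then have "x \<ominus> y \<in> Units R" by (simp add: field_Units r_right_minus_eq)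
  then have "(x \<ominus> y) [^] (2::nat) \<in> Units R" by (rule Units_pow_closed)
  then show ?thesis using xy z by simp
qed

lemma PS_A_iff: "z \<in> PS_A \<longleftrightarrow> z \<in> carrier R \<times> carrier R \<and> (\<forall>i\<ge>1. z \<notin> PS_W i)"
  unfolding PS_A_def by (simp add: Ball_def)

lemma PS_A_off_diagonal:
  assumes "z \<in> PS_A" shows "fst z \<noteq> snd z"
proof -
  have "z \<notin> PS_W (Suc 0)" "z \<in> carrier R \<times> carrier R"
    using assms unfolding PS_A_iff by (simp_all del: PS_W.simps)
  then show ?thesis by (cases z) auto
qed

text \<open>If the image lay in \<open>PS_W i\<close>, then \<open>z\<close>, which avoids all
  earlier sets, would lie in the next one.\<close>

lemma PS_A_invariant:
  assumes z: "z \<in> PS_A" shows "pappus_steiner z \<in> PS_A"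
proof -
  have c: "pappus_steiner z \<in> carrier R \<times> carrier R"
    using pappus_steiner_closed PS_A_off_diagonal z unfolding PS_A_iff by blast
  have zW: "z \<notin> PS_W i" if "i \<ge> 1" for i using z that unfolding PS_A_iff by blast
  have "pappus_steiner z \<notin> PS_W i" if i: "i \<ge> 1" for i
  proof
    assume *: "pappus_steiner z \<in> PS_W i"
    obtain m where "i = Suc m" using i by (cases i) auto
    with * have "pappus_steiner z \<in> PS_W (Suc m)" by (simp only:)
    moreover have "z \<notin> (\<Union>i\<in>{1..Suc m}. PS_W i)"
      using zW by (auto simp del: PS_W.simps)
    ultimately have "z \<in> PS_W (Suc (Suc m))"
      using z unfolding PS_W.simps PS_A_iff by blast
    with zW[of "Suc (Suc m)"] show False by (simp del: PS_W.simps)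
  qed
  with c show ?thesis unfolding PS_A_iff by blast
qed

text \<open>An orbit that stays in \<open>S\<close> never reaches the diagonal, so no index
  \<open>i\<close> can occur. This places a finite cycle in \<open>PS_A\<close> by checking its
  points only.\<close>

lemma PS_A_coinduct:
  assumes S: "S \<subseteq> carrier R \<times> carrier R" "\<And>z. z \<in> S \<Longrightarrow> fst z \<noteq> snd z" "\<And>z. z \<in> S \<Longrightarrow> pappus_steiner z \<in> S"
  shows "S \<subseteq> PS_A"
proof -
  have off: "z \<notin> PS_W i" if "z \<in> S" for z i
    using that
  proof (induction i arbitrary: z rule: PS_W.induct)
    case 2
    then show ?case using S(2)[of z] by (cases z) auto
  next
    case (3 n)
    then show ?case using S(3)[of z] by auto
  qed simp
  show ?thesis
  proof
    fix z assume "z \<in> S"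
    then show "z \<in> PS_A" unfolding PS_A_iff using S(1) off by blast
  qed
qed

end

text \<open>
  In the next three lemmas \<open>f\<close>, \<open>g\<close>, \<open>h\<close>, \<open>k\<close> are representatives of inverses modulo \<open>q\<close>.
\<close>

lemma three_cycle_inverse_square:
  fixes q :: "'a::comm_ring_1"
  assumes 1: "q dvd v * g - 1" and 2: "q dvd w * k - 1" and 3: "q dvd w * (u - v)\<^sup>2 - v\<^sup>2"
  shows "q dvd k - ((u - v) * g)\<^sup>2"
proof -
  \<comment> \<open>Both \<open>k\<close> and \<open>((u - v) * g)^2\<close> turn out to be inverses
    of \<open>w\<close> modulo \<open>q\<close>, hence they agree.\<close>
  have *: "q dvd w * ((u - v) * g)\<^sup>2 - 1"
  proof (rule dvd_eqI)
    show "w * ((u - v) * g)\<^sup>2 - 1 = g\<^sup>2 * (w * (u - v)\<^sup>2 - v\<^sup>2) + (v * g - 1) * (v * g + 1)"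
      by (simp add: algebra_simps power2_eq_square)
  qed (intro dvd_add dvd_mult[OF 3] dvd_mult2[OF 1])
  show ?thesis
  proof (rule dvd_eqI)
    show "k - ((u - v) * g)\<^sup>2 = ((u - v) * g)\<^sup>2 * (w * k - 1) - k * (w * ((u - v) * g)\<^sup>2 - 1)"
      by (simp add: algebra_simps)
  qed (intro dvd_diff dvd_mult[OF 2] dvd_mult[OF *])
qed

text \<open>One and two primes mark the preceding and the following point. With
  \<open>a = (x - y) / y\<close> the map gives \<open>1 / y = a'^2\<close>,
  \<open>1 / y'' = a^2\<close> and \<open>a'' = 4 / y - 2 a - 1\<close>; the factor 4 clears the
  coefficient of \<open>a'^2\<close>.\<close>

lemma three_cycle_step:
  fixes q :: "'a::comm_ring_1"
  assumes f: "q dvd y * f - 1" and F: "q dvd y'' * f'' - 1" and d: "q dvd y' * f' - 1"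
    and y: "q dvd y * (x' - y')\<^sup>2 - y'\<^sup>2"
    and X: "q dvd x'' * (x - y)\<^sup>2 - 2 * y * (y - x + 2)"
    and Y: "q dvd y'' * (x - y)\<^sup>2 - y\<^sup>2"
  shows "q dvd (4 * (x' - y') * f')\<^sup>2 - (2 * (4 * (x - y) * f) + 4 * (x'' - y'') * f'' + 4)"
proof -
  define a where "a = (x - y) * f"
  define a' where "a' = (x' - y') * f'"
  have 1: "q dvd f - a'\<^sup>2" unfolding a'_def by (rule three_cycle_inverse_square[OF d f y])
  have 2: "q dvd f'' - a\<^sup>2" unfolding a_def by (rule three_cycle_inverse_square[OF f F Y])
  have 3: "q dvd (x'' - y'') * a\<^sup>2 - (4 * f - 2 * a - 1)"
  proof (rule dvd_eqI)
    show "(x'' - y'') * a\<^sup>2 - (4 * f - 2 * a - 1)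
      = f\<^sup>2 * (x'' * (x - y)\<^sup>2 - 2 * y * (y - x + 2)) - f\<^sup>2 * (y'' * (x - y)\<^sup>2 - y\<^sup>2)
        + (y * f - 1) * (4 * f - 2 * (x - y) * f - (y * f + 1))"
      by (simp add: a_def algebra_simps power2_eq_square)
  qed (intro dvd_add dvd_diff dvd_mult[OF X] dvd_mult[OF Y] dvd_mult2[OF f])
  show ?thesis
  proof (rule dvd_eqI)
    show "(4 * (x' - y') * f')\<^sup>2 - (2 * (4 * (x - y) * f) + 4 * (x'' - y'') * f'' + 4)
      = - (16 * (f - a'\<^sup>2) + 4 * ((x'' - y'') * (f'' - a\<^sup>2)) + 4 * ((x'' - y'') * a\<^sup>2 - (4 * f - 2 * a - 1)))"
      by (simp add: a_def a'_def algebra_simps power2_eq_square)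
    show "q dvd \<dots>"
      unfolding dvd_minus_iff by (intro dvd_add dvd_mult 1 2 3)
  qed
qed

text \<open>
  A solution \<open>b, c, d\<close> of the rescaled system comes from the points \<open>(c h\<^sup>2 + h\<^sup>2, h\<^sup>2)\<close> and
  \<open>(d g\<^sup>2 + g\<^sup>2, g\<^sup>2)\<close> with \<open>h = 1 / b\<close> and \<open>g = 1 / c\<close>, by solving \<open>y = 1 / b\<^sup>2\<close> and
  \<open>x - y = c y\<close>.
\<close>

lemma three_cycle_step_converse:
  fixes q :: "'a::comm_ring_1"
  assumes b: "q dvd b * h - 1" and c: "q dvd c * g - 1"
    and e: "q dvd 4 * b\<^sup>2 - (2 * c + d + 1)"
  shows "q dvd (d * g\<^sup>2 + g\<^sup>2) * (c * h\<^sup>2 + h\<^sup>2 - h\<^sup>2)\<^sup>2 - 2 * h\<^sup>2 * (h\<^sup>2 - (c * h\<^sup>2 + h\<^sup>2) + 2)"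
    and "q dvd g\<^sup>2 * (c * h\<^sup>2 + h\<^sup>2 - h\<^sup>2)\<^sup>2 - (h\<^sup>2)\<^sup>2"
proof -
  show "q dvd g\<^sup>2 * (c * h\<^sup>2 + h\<^sup>2 - h\<^sup>2)\<^sup>2 - (h\<^sup>2)\<^sup>2"
  proof (rule dvd_eqI)
    show "g\<^sup>2 * (c * h\<^sup>2 + h\<^sup>2 - h\<^sup>2)\<^sup>2 - (h\<^sup>2)\<^sup>2 = (c * g - 1) * ((c * g + 1) * (h\<^sup>2)\<^sup>2)"
      by (simp add: algebra_simps power2_eq_square)
  qed (rule dvd_mult2[OF c])
  show "q dvd (d * g\<^sup>2 + g\<^sup>2) * (c * h\<^sup>2 + h\<^sup>2 - h\<^sup>2)\<^sup>2 - 2 * h\<^sup>2 * (h\<^sup>2 - (c * h\<^sup>2 + h\<^sup>2) + 2)"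
  proof (rule dvd_eqI)
    show "(d * g\<^sup>2 + g\<^sup>2) * (c * h\<^sup>2 + h\<^sup>2 - h\<^sup>2)\<^sup>2 - 2 * h\<^sup>2 * (h\<^sup>2 - (c * h\<^sup>2 + h\<^sup>2) + 2)
      = (c * g - 1) * ((d + 1) * (c * g + 1) * (h\<^sup>2)\<^sup>2) - (4 * b\<^sup>2 - (2 * c + d + 1)) * (h\<^sup>2)\<^sup>2
        + (b * h - 1) * (4 * h\<^sup>2 * (b * h + 1))"
      by (simp add: algebra_simps power2_eq_square)
  qed (intro dvd_add dvd_diff dvd_mult2[OF b] dvd_mult2[OF c] dvd_mult2[OF e])
qed

text \<open>The field is the quotient of a commutative ring by the multiples of \<open>q\<close>, so
  that field equations become divisibilities in a type-class ring. The instances are the rationals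
  with \<open>q = 0\<close> and the integers with \<open>q = p\<close>.\<close>

locale field_presentation = field R for R :: "('b, 'm) ring_scheme" (structure) +
  fixes h :: "'a::comm_ring_1 \<Rightarrow> 'b" and q :: 'a
  assumes range: "range h = carrier R"
    and h_add: "h (u + v) = h u \<oplus> h v"
    and h_mult: "h (u * v) = h u \<otimes> h v"
    and h_one: "h 1 = \<one>"
    and h_eq_iff: "h u = h v \<longleftrightarrow> q dvd u - v"
begin

lemma h_closed [simp]: "h u \<in> carrier R"
  using range by blast

lemma h_zero: "h 0 = \<zero>"
  using h_add[of 0 0] by (metis add_0_right h_closed r_neg r_neg2 r_zero add.r_cancel_one')

lemma h_minus: "h (- u) = \<ominus> h u"
  using h_add[of "- u" u] by (intro minus_equality[symmetric]) (simp_all add: h_zero)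

lemma h_diff: "h (u - v) = h u \<ominus> h v"
  using h_add[of u "- v"] by (simp add: h_minus minus_eq)

lemma h_power2: "h (u\<^sup>2) = h u [^] (2::nat)"
  by (simp add: power2_eq_square h_mult numeral_2_eq_2)

lemma h_zero_iff: "h u = \<zero> \<longleftrightarrow> q dvd u"
  using h_eq_iff[of u 0] by (simp add: h_zero)

lemma q_prime: "q dvd u * v \<Longrightarrow> q dvd u \<or> q dvd v"
  by (simp flip: h_zero_iff add: h_mult integral_iff)

lemma q_inverse: "\<not> q dvd u \<Longrightarrow> \<exists>v. q dvd u * v - 1"
proof -
  assume "\<not> q dvd u"
  then have u: "h u \<in> Units R" by (simp add: field_Units flip: h_zero_iff)
  then obtain v where v: "inv (h u) = h v" using range by blast
  have "h u \<otimes> inv (h u) = \<one>" using u by (rule Units_r_inv)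
  then have "h (u * v) = h 1" unfolding v by (simp add: h_mult h_one)
  then show ?thesis using h_eq_iff by blast
qed

text \<open>Off the diagonal \<open>(x - y)^2\<close> is a unit, so denominators can be
  cleared.\<close>

lemma pappus_steiner_h_iff:
  assumes "\<not> q dvd x - y"
  shows "pappus_steiner (h x, h y) = (h x'', h y'') \<longleftrightarrow>
    q dvd x'' * (x - y)\<^sup>2 - 2 * y * (y - x + 2) \<and> q dvd y'' * (x - y)\<^sup>2 - y\<^sup>2"
proof -
  have "h ((x - y)\<^sup>2) \<noteq> \<zero>"
    using assms q_prime[of "x - y" "x - y"] by (auto simp: h_zero_iff power2_eq_square)
  then have D: "h ((x - y)\<^sup>2) \<in> Units R"
    by (simp add: field_Units)
  have div: "h u \<otimes> inv (h ((x - y)\<^sup>2)) = h v \<longleftrightarrow> q dvd v * (x - y)\<^sup>2 - u" for u v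
  proof -
    have "h u \<otimes> inv (h ((x - y)\<^sup>2)) = h v \<longleftrightarrow> h v \<otimes> h ((x - y)\<^sup>2) = h u"
      using D by (metis Units_closed Units_inv_closed Units_l_inv Units_r_inv h_closed m_assoc r_one)
    also have "\<dots> \<longleftrightarrow> q dvd v * (x - y)\<^sup>2 - u"
      by (simp flip: h_mult add: h_eq_iff)
    finally show ?thesis .
  qed
  have two: "h 2 = \<one> \<oplus> \<one>"
    using h_add[of 1 1] by (simp add: h_one)
  have "pappus_steiner (h x, h y) = (h (2 * y * (y - x + 2)) \<otimes> inv (h ((x - y)\<^sup>2)), h (y\<^sup>2) \<otimes> inv (h ((x - y)\<^sup>2)))"
    by (simp add: h_mult h_diff h_add h_power2 two)
  then show ?thesis by (simp only: prod.inject div)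
qed

lemma pair_h: "z \<in> carrier R \<times> carrier R \<Longrightarrow> \<exists>x y. z = (h x, h y)"
  using range by (cases z) (force simp: image_iff)

end

context field_presentation
begin

lemma q_inverse_not_dvd:
  assumes "\<not> q dvd 1" "q dvd u * v - 1"
  shows "\<not> q dvd u" "\<not> q dvd v"
proof -
  have "\<not> q dvd u * v"
    using assms dvd_diff[of q "u * v" "u * v - 1"] by auto
  then show "\<not> q dvd u" "\<not> q dvd v"
    by auto
qed

text \<open>The unknowns are the values of \<open>4 (x - y) / y\<close> along the orbit. They cannot
  all agree, since these ratios determine the points.\<close>

lemma period_3_imp_three_cycle:
  assumes 2: "\<not> q dvd 2" and z: "PS_point_of_period 3 z"
  shows "\<exists>A B C. q dvd A\<^sup>2 - (2 * B + C + 4) \<and> q dvd B\<^sup>2 - (2 * C + A + 4) \<and> q dvd C\<^sup>2 - (2 * A + B + 4) \<and>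
      \<not> (q dvd A - B \<and> q dvd B - C) \<and> \<not> q dvd A \<and> \<not> q dvd B \<and> \<not> q dvd C"
proof -
  have 1: "\<not> q dvd 1" using 2 dvd_trans[of q 1 2] by auto
  have 4: "\<not> q dvd 4" using 2 q_prime[of 2 2] by auto
  have zA: "z \<in> PS_A" and per: "has_period pappus_steiner z 3"
    using z by (auto simp: PS_point_of_period_def)
  let ?\<pi> = pappus_steiner
  have z3: "?\<pi> (?\<pi> (?\<pi> z)) = z"
    using per by (simp add: has_period_def numeral_3_eq_3)
  have z1: "?\<pi> z \<noteq> z"
    using per unfolding has_period_def by (auto dest!: spec[of _ 1])
  have A: "?\<pi> z \<in> PS_A" "?\<pi> (?\<pi> z) \<in> PS_A"
    using zA PS_A_invariant by blast+
  obtain x0 y0 where p0: "z = (h x0, h y0)"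
    using pair_h zA PS_A_iff by blast
  obtain x1 y1 where p1: "?\<pi> z = (h x1, h y1)"
    using pair_h A(1) PS_A_iff by blast
  obtain x2 y2 where p2: "?\<pi> (?\<pi> z) = (h x2, h y2)"
    using pair_h A(2) PS_A_iff by blast
  have d0: "\<not> q dvd x0 - y0"
    using PS_A_off_diagonal[OF zA] unfolding p0 fst_conv snd_conv h_eq_iff .
  have d1: "\<not> q dvd x1 - y1"
    using PS_A_off_diagonal[OF A(1)] unfolding p1 fst_conv snd_conv h_eq_iff .
  have d2: "\<not> q dvd x2 - y2"
    using PS_A_off_diagonal[OF A(2)] unfolding p2 fst_conv snd_conv h_eq_iff .
  have s0: "q dvd x1 * (x0 - y0)\<^sup>2 - 2 * y0 * (y0 - x0 + 2)" "q dvd y1 * (x0 - y0)\<^sup>2 - y0\<^sup>2"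
    using p1 pappus_steiner_h_iff[OF d0] unfolding p0 by blast+
  have s1: "q dvd x2 * (x1 - y1)\<^sup>2 - 2 * y1 * (y1 - x1 + 2)" "q dvd y2 * (x1 - y1)\<^sup>2 - y1\<^sup>2"
    using p2 pappus_steiner_h_iff[OF d1] unfolding p1 by blast+
  have s2: "q dvd x0 * (x2 - y2)\<^sup>2 - 2 * y2 * (y2 - x2 + 2)" "q dvd y0 * (x2 - y2)\<^sup>2 - y2\<^sup>2"
    using z3[unfolded p2, unfolded p0] pappus_steiner_h_iff[OF d2] by blast+
  \<comment> \<open>A point with \<open>y = 0\<close> is mapped to the origin, which lies on the
    diagonal.\<close>
  have y_nz: "\<not> q dvd y"
    if "\<not> q dvd x - y" "\<not> q dvd x' - y'"
      "q dvd x' * (x - y)\<^sup>2 - 2 * y * (y - x + 2)" "q dvd y' * (x - y)\<^sup>2 - y\<^sup>2" for x y x' y'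
  proof
    assume y: "q dvd y"
    have sq: "\<not> q dvd (x - y)\<^sup>2"
      using that(1) q_prime[of "x - y" "x - y"] by (auto simp: power2_eq_square)
    have "q dvd x' * (x - y)\<^sup>2"
      using dvd_add[OF that(3) dvd_mult2[OF dvd_mult[OF y, of 2], of "y - x + 2"]]
      by (simp only: diff_add_cancel)
    moreover have "q dvd y' * (x - y)\<^sup>2"
      using dvd_add[OF that(4) dvd_mult[OF y, of y]]
      by (simp only: power2_eq_square[of y] diff_add_cancel)
    ultimately have "q dvd x'" "q dvd y'"
      using sq q_prime by blast+
    with that(2) show False by (simp add: dvd_diff)
  qed
  obtain f0 where f0: "q dvd y0 * f0 - 1" using q_inverse y_nz[OF d0 d1 s0] by blast
  obtain f1 where f1: "q dvd y1 * f1 - 1" using q_inverse y_nz[OF d1 d2 s1] by blast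
  obtain f2 where f2: "q dvd y2 * f2 - 1" using q_inverse y_nz[OF d2 d0 s2] by blast
  have nz: "\<not> q dvd 4 * (x - y) * f" if "\<not> q dvd x - y" "q dvd y * f - 1" for x y f
    using that q_prime 4 q_inverse_not_dvd(2)[OF 1 that(2)] by blast
  have ne: "\<not> (q dvd 4 * (x0 - y0) * f0 - 4 * (x1 - y1) * f1 \<and> q dvd 4 * (x1 - y1) * f1 - 4 * (x2 - y2) * f2)"
  proof
    assume eq: "q dvd 4 * (x0 - y0) * f0 - 4 * (x1 - y1) * f1 \<and> q dvd 4 * (x1 - y1) * f1 - 4 * (x2 - y2) * f2"
    define a0 where "a0 = (x0 - y0) * f0"
    define a1 where "a1 = (x1 - y1) * f1"
    define a2 where "a2 = (x2 - y2) * f2"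
    have a01: "q dvd a0 - a1"
    proof -
      have *: "4 * (x0 - y0) * f0 - 4 * (x1 - y1) * f1 = 4 * (a0 - a1)"
        by (simp add: a0_def a1_def algebra_simps)
      show ?thesis using eq 4 q_prime unfolding * by blast
    qed
    have a12: "q dvd a1 - a2"
    proof -
      have *: "4 * (x1 - y1) * f1 - 4 * (x2 - y2) * f2 = 4 * (a1 - a2)"
        by (simp add: a1_def a2_def algebra_simps)
      show ?thesis using eq 4 q_prime unfolding * by blast
    qed
    \<comment> \<open>Each ratio determines the next \<open>y\<close> through
      \<open>1 / y = a^2\<close>. Equal ratios thus give equal \<open>y\<close>, then equal
      \<open>x = y (a + 1)\<close>, and \<open>z\<close> would be fixed.\<close>
    have fa: "q dvd f1 - a0\<^sup>2" "q dvd f0 - a2\<^sup>2"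
      unfolding a0_def a2_def
      by (rule three_cycle_inverse_square[OF f0 f1 s0(2)], rule three_cycle_inverse_square[OF f2 f0 s2(2)])
    have f: "q dvd f1 - f0"
    proof (rule dvd_eqI)
      show "f1 - f0 = (f1 - a0\<^sup>2) - (f0 - a2\<^sup>2) + ((a0 - a1) + (a1 - a2)) * (a0 + a2)"
        by (simp add: algebra_simps power2_eq_square)
    qed (intro dvd_add dvd_diff dvd_mult2 fa a01 a12)
    have y: "q dvd y1 - y0"
    proof (rule dvd_eqI)
      show "y1 - y0 = (y1 * f1 - 1) * y0 - (y0 * f0 - 1) * y1 - (f1 - f0) * (y0 * y1)"
        by (simp add: algebra_simps)
    qed (intro dvd_add dvd_diff dvd_mult2 f f0 f1)
    have "q dvd x1 - x0"
    proof (rule dvd_eqI)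
      show "x1 - x0 = (y0 * f0 - 1) * (x0 - y0) - (y1 * f1 - 1) * (x1 - y1) - (a0 - a1) * y0 + (y1 - y0) * (a1 + 1)"
        by (simp add: a0_def a1_def algebra_simps)
    qed (intro dvd_add dvd_diff dvd_mult2 f0 f1 a01 y)
    with y have "?\<pi> z = z" unfolding p1 unfolding p0 by (simp add: h_eq_iff)
    with z1 show False by blast
  qed
  show ?thesis
    using three_cycle_step[OF f1 f2 f0 s0(2) s1] three_cycle_step[OF f2 f0 f1 s1(2) s2]
      three_cycle_step[OF f0 f1 f2 s2(2) s0] ne nz[OF d0 f0] nz[OF d1 f1] nz[OF d2 f2] by blast
qed

text \<open>After division by 4 the unknowns serve as the ratios \<open>(x - y) / y\<close> of three
  points, and each \<open>y\<close> is the inverse square of the preceding ratio.\<close>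

lemma three_cycle_imp_period_3:
  assumes 2: "\<not> q dvd 2"
    and E: "q dvd A\<^sup>2 - (2 * B + C + 4)" "q dvd B\<^sup>2 - (2 * C + A + 4)" "q dvd C\<^sup>2 - (2 * A + B + 4)"
    and ne: "\<not> (q dvd A - B \<and> q dvd B - C)" and nz: "\<not> q dvd A" "\<not> q dvd B" "\<not> q dvd C"
  shows "\<exists>z. PS_point_of_period 3 z"
proof -
  have 1: "\<not> q dvd 1" using 2 dvd_trans[of q 1 2] by auto
  have 4: "\<not> q dvd 4" using 2 q_prime[of 2 2] by auto
  obtain r where r: "q dvd 4 * r - 1" using q_inverse[OF 4] by blast
  define a where "a = r * A"
  define b where "b = r * B"
  define c where "c = r * C"
  have scale: "q dvd 4 * (r * u)\<^sup>2 - (2 * (r * v) + r * w + 1)" if "q dvd u\<^sup>2 - (2 * v + w + 4)" for u v w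
  proof (rule dvd_eqI)
    show "4 * (r * u)\<^sup>2 - (2 * (r * v) + r * w + 1)
      = (u\<^sup>2 - (2 * v + w + 4)) * (4 * r\<^sup>2) + (4 * r - 1) * (2 * r * v + r * w + 4 * r + 1)"
      by (simp add: algebra_simps power2_eq_square)
  qed (intro dvd_add dvd_mult2 that r)
  have e: "q dvd 4 * a\<^sup>2 - (2 * b + c + 1)" "q dvd 4 * b\<^sup>2 - (2 * c + a + 1)" "q dvd 4 * c\<^sup>2 - (2 * a + b + 1)"
    unfolding a_def b_def c_def by (rule scale, rule E)+
  have "\<not> q dvd r" using q_inverse_not_dvd(2)[OF 1 r] .
  then have anz: "\<not> q dvd a" "\<not> q dvd b" "\<not> q dvd c"
    unfolding a_def b_def c_def using nz q_prime by blast+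
  obtain a' where a': "q dvd a * a' - 1" using q_inverse[OF anz(1)] by blast
  obtain b' where b': "q dvd b * b' - 1" using q_inverse[OF anz(2)] by blast
  obtain c' where c': "q dvd c * c' - 1" using q_inverse[OF anz(3)] by blast
  note inv = a' b' c'
  \<comment> \<open>For invertible \<open>k\<close> this is the point with \<open>y = k^2\<close>
    and \<open>(x - y) / y = u\<close>.\<close>
  define P where "P = (\<lambda>u k. (h (u * k\<^sup>2 + k\<^sup>2), h (k\<^sup>2)))"
  have off: "\<not> q dvd (u * k\<^sup>2 + k\<^sup>2) - k\<^sup>2" if "\<not> q dvd u" "q dvd v * k - 1" for u v k
    using that(1) q_inverse_not_dvd(2)[OF 1 that(2)] q_prime by (auto simp: power2_eq_square)
  have step: "pappus_steiner (P v k) = P w l"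
    if "\<not> q dvd v" "q dvd u * k - 1" "q dvd v * l - 1" "q dvd 4 * u\<^sup>2 - (2 * v + w + 1)" for u v w k l
    unfolding P_def pappus_steiner_h_iff[OF off[OF that(1,2)]]
    using three_cycle_step_converse[OF that(2-4)] by blast
  have s: "pappus_steiner (P a c') = P b a'" "pappus_steiner (P b a') = P c b'" "pappus_steiner (P c b') = P a c'"
    by (rule step; fact anz inv e)+
  have "{P a c', P b a', P c b'} \<subseteq> PS_A"
  proof (rule PS_A_coinduct)
    show "{P a c', P b a', P c b'} \<subseteq> carrier R \<times> carrier R"
      by (simp add: P_def)
    fix z assume z: "z \<in> {P a c', P b a', P c b'}"
    then show "fst z \<noteq> snd z"
      using off[OF anz(1) inv(3)] off[OF anz(2) inv(1)] off[OF anz(3) inv(2)]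
      unfolding P_def by (auto simp only: insert_iff empty_iff fst_conv snd_conv h_eq_iff)
    show "pappus_steiner z \<in> {P a c', P b a', P c b'}"
      using z s by auto
  qed
  \<comment> \<open>If two consecutive points coincided, so would all three; comparing ratios would
    then give a constant solution.\<close>
  moreover have "P a c' \<noteq> P b a'"
  proof
    assume eq: "P a c' = P b a'"
    then have eq': "P b a' = P c b'" using s by metis
    have ex: "q dvd u - v" if "P u k = P v l" "q dvd w * k - 1" for u v w k l
    proof -
      have 1: "q dvd (u * k\<^sup>2 + k\<^sup>2) - (v * l\<^sup>2 + l\<^sup>2)" "q dvd k\<^sup>2 - l\<^sup>2"
        using that(1) by (simp_all add: P_def h_eq_iff)
      have "q dvd (u - v) * k\<^sup>2"
      proof (rule dvd_eqI)
        show "(u - v) * k\<^sup>2 = ((u * k\<^sup>2 + k\<^sup>2) - (v * l\<^sup>2 + l\<^sup>2)) - (k\<^sup>2 - l\<^sup>2) * (v + 1)"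
          by (simp add: algebra_simps)
      qed (intro dvd_diff dvd_mult2 1)
      then show ?thesis
        using q_inverse_not_dvd(2)[OF \<open>\<not> q dvd 1\<close> that(2)] q_prime unfolding power2_eq_square by blast
    qed
    have up: "q dvd u - v" if "q dvd r * u - r * v" for u v
    proof (rule dvd_eqI)
      show "u - v = (r * u - r * v) * 4 - (4 * r - 1) * (u - v)"
        by (simp add: algebra_simps)
    qed (intro dvd_diff dvd_mult2 that r)
    have "q dvd A - B \<and> q dvd B - C"
      using up ex[OF eq inv(3)] ex[OF eq' inv(1)] unfolding a_def b_def c_def by blast
    with ne show False by blast
  qed
  \<comment> \<open>Applying the map to \<open>P c b' = P a c'\<close> would give
    \<open>P a c' = P b a'\<close>.\<close>
  moreover from this have "P c b' \<noteq> P a c'" using s by metis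
  ultimately have "PS_point_of_period 3 (P a c')"
    using s by (auto simp: PS_point_of_period_def has_period_def numeral_3_eq_3 less_Suc_eq)
  then show ?thesis by blast
qed

lemma period_3_iff_cubic_root:
  assumes "\<not> q dvd 2" "\<not> q dvd 3" "\<not> q dvd 7" "\<not> q dvd 13"
  shows "(\<exists>z. PS_point_of_period 3 z) \<longleftrightarrow>
    (\<exists>a. q dvd a ^ 3 + a\<^sup>2 - 2 * a - 1) \<or> (\<exists>a. q dvd a ^ 3 + a\<^sup>2 - 4 * a + 1)"
proof -
  have "(\<exists>z. PS_point_of_period 3 z) \<longleftrightarrow>
    (\<exists>A B C. q dvd A\<^sup>2 - (2 * B + C + 4) \<and> q dvd B\<^sup>2 - (2 * C + A + 4) \<and> q dvd C\<^sup>2 - (2 * A + B + 4) \<and>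
      \<not> (q dvd A - B \<and> q dvd B - C) \<and> \<not> q dvd A \<and> \<not> q dvd B \<and> \<not> q dvd C)"
    using period_3_imp_three_cycle[OF assms(1)] three_cycle_imp_period_3[OF assms(1)] by blast
  then show ?thesis
    using three_cycle_iff_cubic_root[OF q_prime assms] by simp
qed

end

section \<open>The rationals and the prime fields\<close>

text \<open>Clearing denominators gives a form that reduces to \<open>m^3 + m^2 n + n^3\<close>
  modulo 2. Its only zero modulo 2 has \<open>m\<close> and \<open>n\<close> both even, against
  coprimality.\<close>

lemma no_rational_cubic_root:
  fixes a :: rat and c d :: int
  assumes "even c" "odd d"
  shows "a ^ 3 + a\<^sup>2 + of_int c * a + of_int d \<noteq> 0"
proof
  assume 0: "a ^ 3 + a\<^sup>2 + of_int c * a + of_int d = 0"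
  obtain m n where mn: "quotient_of a = (m, n)" by (cases "quotient_of a")
  have n: "n > 0" and cop: "coprime m n" and a: "a = of_int m / of_int n"
    using quotient_of_denom_pos[OF mn] quotient_of_coprime[OF mn] quotient_of_div[OF mn] by auto
  have "of_int (m ^ 3 + m\<^sup>2 * n + c * m * n\<^sup>2 + d * n ^ 3) = (a ^ 3 + a\<^sup>2 + of_int c * a + of_int d) * of_int n ^ 3"
    using n by (simp add: a field_simps eval_nat_numeral)
  with 0 have "m ^ 3 + m\<^sup>2 * n + c * m * n\<^sup>2 + d * n ^ 3 = 0"
    by (metis mult_zero_left of_int_eq_0_iff)
  then have "even (m ^ 3 + m\<^sup>2 * n + c * m * n\<^sup>2 + d * n ^ 3)" by simp
  then have "even m" "even n" using assms by auto
  with cop show False by (meson coprime_common_divisor odd_one)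
qed

lemma rat_presentation: "field_presentation (ring_of_type_algebra :: rat ring) id 0"
proof -
  interpret field "ring_of_type_algebra :: rat ring" by (rule field_from_type_algebra)
  show ?thesis
    by unfold_locales (simp_all add: ring_of_type_algebra_def)
qed

lemma residue_ring_presentation:
  assumes "prime p"
  shows "field_presentation (residue_ring (int p)) (\<lambda>x. x mod int p) (int p)"
proof -
  interpret residues_prime p "residue_ring (int p)"
    by unfold_locales (rule assms)
  have "range (\<lambda>x. x mod int p) = {0..int p - 1}"
  proof (intro equalityI subsetI)
    fix x assume "x \<in> {0..int p - 1}"
    then have "x = x mod int p" by simp
    then show "x \<in> range (\<lambda>x. x mod int p)" by blast
  qed (use assms prime_gt_0_nat in auto)
  then show ?thesis
    by unfold_locales (simp_all add: res_carrier_eq add_cong mult_cong one_cong mod_eq_dvd_iff)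
qed

theorem theorem4p2:
  shows "\<not> (\<exists>z. field.PS_point_of_period (ring_of_type_algebra :: rat ring) 3 z) \<and>
    (\<exists>N::nat. \<forall>p::nat. prime p \<and> p > N \<longrightarrow>
      ((\<exists>z. field.PS_point_of_period (residue_ring (int p)) 3 z) \<longleftrightarrow>
        ([p = 1] (mod 13) \<or> [p = 5] (mod 13) \<or> [p = 8] (mod 13) \<or> [p = 12] (mod 13)) \<or>
        ([p = 1] (mod 7) \<or> [p = 6] (mod 7))))"
proof (intro conjI exI allI impI)
  show "\<not> (\<exists>z. field.PS_point_of_period (ring_of_type_algebra :: rat ring) 3 z)"
    using field_presentation.period_3_iff_cubic_root[OF rat_presentation]
      no_rational_cubic_root[of "- 2" "- 1"] no_rational_cubic_root[of "- 4" 1]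
    by simp
  fix p :: nat
  \<comment> \<open>The bound \<open>N\<close> is 13, so that \<open>p\<close> divides none of 2, 3,
    7 and 13.\<close>
  assume "prime p \<and> p > 13"
  then have p: "prime p" and p13: "p > 13" by auto
  have ndvd: "\<not> int p dvd k" if "0 < k" "k \<le> 13" for k
    using that p13 by (auto dest!: zdvd_imp_le)
  have "(\<exists>z. field.PS_point_of_period (residue_ring (int p)) 3 z) \<longleftrightarrow>
      p mod 7 \<in> {1, 6} \<or> p mod 13 \<in> {1, 5, 8, 12}"
    using field_presentation.period_3_iff_cubic_root[OF residue_ring_presentation[OF p]]
      root_conductor_7_iff[OF p] root_conductor_13_iff[OF p] p13 by (simp add: ndvd)
  then show "(\<exists>z. field.PS_point_of_period (residue_ring (int p)) 3 z) \<longleftrightarrow>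
        ([p = 1] (mod 13) \<or> [p = 5] (mod 13) \<or> [p = 8] (mod 13) \<or> [p = 12] (mod 13)) \<or>
        ([p = 1] (mod 7) \<or> [p = 6] (mod 7))"
    by (auto simp: cong_def)
qed

end
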